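(* Let $1\le p<\infty$ and let $w$ be an integrable radial weight on the unit disk $\mathbb{D}$. Then the Korenblum domination principle holds for the weighted Bergman space $A^p_w$; that is, there exists $c\in(0,1)$ such that for all $f,g\in A^p_w$ satisfying $|f(z)|\le |g(z)|$ whenever $c\le |z|<1$, one has $\|f\|_{p,w}\le \|g\|_{p,w}$.
   Context: $\mathbb{D}=\{z\in\mathbb{C}:|z|<1\}$ and $dA=\frac1\pi\,dx\,dy$ is the normalized Lebesgue area measure on $\mathbb{D}$. A weight is a measurable function $w:\mathbb{D}\to[0,\infty)$ with $\int_{\mathbb{D}} w\,dA>0$. It is integrable if $\int_{\mathbb{D}} w\,dA<\infty$, and radial if $w(z)=w(|z|)$ for all $z\in\mathbb{D}$. No other regularity or positivity of $w$ is assumed. For $0<p<\infty$, $A^p_w$ is the set of all holomorphic functions $f$ in $\mathbb{D}$ with $\|f\|_{p,w}=\left(\int_{\mathbb{D}}|f|^p w\,dA\right)^{1/p}<\infty$. *)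

theory Defs
  imports "HOL-Complex_Analysis.Complex_Analysis"
begin

abbreviation unit_disk :: "complex set"
  where "unit_disk \<equiv> ball 0 1"

definition disk_area :: "complex measure"
  where "disk_area = scale_measure (ennreal (1 / pi)) (lebesgue_on unit_disk)"

text \<open>
  Functions on the disk are total functions on \<^typ>\<open>complex\<close>; every condition below
  concerns their values on the disk only. Measurability is Lebesgue measurability.
\<close>

definition is_weight :: "(complex \<Rightarrow> real) \<Rightarrow> bool"
  where "is_weight w \<longleftrightarrow>
    w \<in> borel_measurable (lebesgue_on unit_disk) \<and>
    (\<forall>z\<in>unit_disk. 0 \<le> w z) \<and>
    0 < (\<integral>\<^sup>+ z. ennreal (w z) \<partial>disk_area)"

definition integrable_weight :: "(complex \<Rightarrow> real) \<Rightarrow> bool"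
  where "integrable_weight w \<longleftrightarrow>
    is_weight w \<and> (\<integral>\<^sup>+ z. ennreal (w z) \<partial>disk_area) < \<infinity>"

definition radial :: "(complex \<Rightarrow> real) \<Rightarrow> bool"
  where "radial w \<longleftrightarrow> (\<forall>z\<in>unit_disk. w z = w (complex_of_real (cmod z)))"

definition bergman_integral :: "real \<Rightarrow> (complex \<Rightarrow> real) \<Rightarrow> (complex \<Rightarrow> complex) \<Rightarrow> ennreal"
  where "bergman_integral p w f = (\<integral>\<^sup>+ z. ennreal (cmod (f z) powr p * w z) \<partial>disk_area)"

definition bergman_space :: "real \<Rightarrow> (complex \<Rightarrow> real) \<Rightarrow> (complex \<Rightarrow> complex) set"
  where "bergman_space p w =
    {f. f holomorphic_on unit_disk \<and> bergman_integral p w f < \<infinity>}"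

text \<open>
  Meaningful only when \<^term>\<open>bergman_integral p w f\<close> is finite, in particular
  for members of \<^term>\<open>bergman_space p w\<close>, as \<^const>\<open>enn2real\<close> sends infinity to 0.
\<close>

definition bergman_norm :: "real \<Rightarrow> (complex \<Rightarrow> real) \<Rightarrow> (complex \<Rightarrow> complex) \<Rightarrow> real"
  where "bergman_norm p w f = enn2real (bergman_integral p w f) powr (1 / p)"

definition korenblum_domination :: "real \<Rightarrow> (complex \<Rightarrow> real) \<Rightarrow> bool"
  where "korenblum_domination p w \<longleftrightarrow>
    (\<exists>c::real. 0 < c \<and> c < 1 \<and>
      (\<forall>f \<in> bergman_space p w. \<forall>g \<in> bergman_space p w.
        (\<forall>z. c \<le> cmod z \<and> cmod z < 1 \<longrightarrow> cmod (f z) \<le> cmod (g z)) \<longrightarrow>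
        bergman_norm p w f \<le> bergman_norm p w g))"

end

theory Submission
  imports Defs
begin

text \<open>
  For a unimodular constant \<open>u\<close> one has \<open>|f|\<^sup>p - |g|\<^sup>p \<le> p |f|\<^sup>p\<^sup>-\<^sup>1 |f - u g|\<close>, and the right-hand side
  is the modulus of a holomorphic function once the zeros of \<open>f\<close> are removed by Blaschke factors.
  Hence its values near \<open>0\<close> are bounded by its mean over any circle \<open>|z| = r\<close>. On an annulus
  \<open>r1 \<le> |z| \<le> r2\<close> carrying mass of \<open>w\<close>, Harnack's inequality applied to \<open>1 - h / u\<close>, where
  \<open>h = f / g\<close> has modulus at most \<open>1\<close>, provides a \<open>u\<close> with
  \<open>|f - u g| \<le> C (|g| - |f|)\<close>, where \<open>C\<close> does not depend on \<open>f\<close>, \<open>g\<close> and \<open>c\<close>. So the excess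
  of \<open>|f|\<^sup>p\<close> over \<open>|g|\<^sup>p\<close> near \<open>0\<close> is at most a constant times the mean of \<open>|g|\<^sup>p - |f|\<^sup>p\<close> over each circle
  of the annulus, and this gain wins when the disk \<open>|z| < c\<close> carries little mass. The passage from
  circle means to integrals against \<open>w\<close> only uses rotation invariance, not polar coordinates.
\<close>

section \<open>Circle means\<close>

text \<open>This is why Blaschke factors work: the right-hand side is nonnegative when
  \<open>a\<close> and \<open>z\<close> lie in the disk of radius \<open>r\<close>, and it vanishes
  when \<open>z\<close> is on the boundary circle.\<close>

lemma cmod_blaschke_diff:
  fixes a z :: complex and r :: real
  shows "(cmod (of_real (r\<^sup>2) - cnj a * z))\<^sup>2 - (r * cmod (z - a))\<^sup>2
    = (r\<^sup>2 - (cmod z)\<^sup>2) * (r\<^sup>2 - (cmod a)\<^sup>2)"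
  unfolding power_mult_distrib cmod_power2
  by (simp add: power2_eq_square algebra_simps)

text \<open>Glues the local factor near \<open>a\<close> to \<open>f z / (z - a) ^ n\<close> on the
  rest of \<open>S\<close>. At \<open>z = a\<close> the product formula holds because
  \<open>f a = 0\<close> and \<open>0 < n\<close>.\<close>

lemma holomorphic_factor_zero_global:
  assumes f: "f holomorphic_on S" and S: "open S" "connected S" "a \<in> S" "f a = 0"
    and nc: "\<not> f constant_on S"
  obtains g n where "g holomorphic_on S" "g a \<noteq> 0" "\<And>z. z \<in> S \<Longrightarrow> f z = (z - a) ^ n * g z"
proof -
  obtain g r n where g: "0 < n" "0 < r" "ball a r \<subseteq> S" "g holomorphic_on ball a r"
     "\<And>w. w \<in> ball a r \<Longrightarrow> f w = (w - a)^n * g w" "\<And>w. w \<in> ball a r \<Longrightarrow> g w \<noteq> 0"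
    using holomorphic_factor_zero_nonconstant[OF f S nc] by metis
  define h where "h = (\<lambda>z. if z = a then g a else f z / (z - a)^n)"
  have 1: "h holomorphic_on ball a r"
    by (rule holomorphic_transform[OF g(4)]) (use g in \<open>auto simp: h_def\<close>)
  have 2: "h holomorphic_on S - {a}"
  proof (rule holomorphic_transform)
    show "(\<lambda>z. f z / (z - a)^n) holomorphic_on S - {a}"
      by (intro holomorphic_intros holomorphic_on_subset[OF f]) auto
  qed (auto simp: h_def)
  have "h holomorphic_on ball a r \<union> (S - {a})"
    using 1 2 S(1) by (intro holomorphic_on_Un) (auto simp: open_delete)
  moreover have "ball a r \<union> (S - {a}) = S" using g(2,3) S(3) by auto
  ultimately have "h holomorphic_on S" by simp
  moreover have "h a \<noteq> 0" using g(2,6) by (auto simp: h_def)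
  moreover have "f z = (z - a)^n * h z" if "z \<in> S" for z
    using S(4) g(1) by (auto simp: h_def)
  ultimately show thesis using that by blast
qed

text \<open>Each factor \<open>z - a\<close> from a zero in the open disk is traded for the
  denominator of its Blaschke factor, which has the same modulus on the circle, is no smaller inside
  and has no zero there. The induction is on the number of distinct zeros.\<close>

lemma blaschke_zero_removal:
  fixes f :: "complex \<Rightarrow> complex"
  assumes f: "f holomorphic_on ball 0 R" and r: "0 < r" "r < R"
    and nz: "\<exists>z\<in>ball 0 R. f z \<noteq> 0"
  shows "\<exists>F. F holomorphic_on ball 0 R \<and> (\<forall>z\<in>ball 0 r. F z \<noteq> 0) \<and>
    (\<forall>z\<in>cball 0 r. cmod (f z) \<le> cmod (F z)) \<and> (\<forall>z\<in>sphere 0 r. cmod (f z) = cmod (F z))"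
  using f nz
proof (induction "card {z\<in>ball 0 r. f z = 0}" arbitrary: f rule: less_induct)
  case less
  let ?Z = "\<lambda>f. {z\<in>ball 0 r. f z = 0}"
  show ?case
  proof (cases "\<exists>a\<in>ball 0 r. f a = 0")
    case False
    then show ?thesis using less.prems by (intro exI[of _ f]) auto
  next
    case True
    then obtain a where a: "cmod a < r" "f a = 0" by auto
    have aS: "a \<in> ball 0 R" using a r by auto
    have nc: "\<not> f constant_on ball 0 R"
      using less.prems(2) a(2) aS unfolding constant_on_def by force
    \<comment> \<open>Only zeros in the open disk are counted, but finiteness comes from compactness
      of the closed one. Zeros on the circle stay.\<close>
    have "finite {z\<in>cball 0 r. f z = 0}"
      by (rule holomorphic_compact_finite_zeros[OF less.prems(1) _ _ _ _ nc]) (use r in auto)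
    then have fin: "finite (?Z f)" by (rule rev_finite_subset) auto
    obtain g n where g: "g holomorphic_on ball 0 R" "g a \<noteq> 0"
        "\<And>z. z \<in> ball 0 R \<Longrightarrow> f z = (z - a) ^ n * g z"
      using holomorphic_factor_zero_global[OF less.prems(1) _ _ aS a(2) nc] by auto
    define b where "b z = (of_real (r\<^sup>2) - cnj a * z) / of_real r" for z
    have b_le: "cmod (z - a) \<le> cmod (b z)" if "cmod z \<le> r" for z
    proof -
      have "0 \<le> (r\<^sup>2 - (cmod z)\<^sup>2) * (r\<^sup>2 - (cmod a)\<^sup>2)"
        using that a(1) by (intro mult_nonneg_nonneg) (auto intro!: power_mono)
      then have "(r * cmod (z - a))\<^sup>2 \<le> (cmod (of_real (r\<^sup>2) - cnj a * z))\<^sup>2"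
        using cmod_blaschke_diff[of r a z] by linarith
      then have "r * cmod (z - a) \<le> cmod (of_real (r\<^sup>2) - cnj a * z)"
        by (rule power2_le_imp_le) simp
      then show ?thesis using r(1) by (simp add: b_def norm_divide field_simps)
    qed
    have b_eq: "cmod (z - a) = cmod (b z)" if "cmod z = r" for z
    proof -
      have "(r * cmod (z - a))\<^sup>2 = (cmod (of_real (r\<^sup>2) - cnj a * z))\<^sup>2"
        using cmod_blaschke_diff[of r a z] that by simp
      then have "r * cmod (z - a) = cmod (of_real (r\<^sup>2) - cnj a * z)"
        using r(1) by (simp add: power2_eq_iff_nonneg)
      then show ?thesis using r(1) by (simp add: b_def norm_divide field_simps)
    qed
    \<comment> \<open>Off \<open>a\<close> this follows from \<open>b_le\<close>; at
      \<open>a\<close> that bound is void, and the value is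
      \<open>(r^2 - |a|^2) / r\<close>.\<close>
    have b_nz: "b z \<noteq> 0" if "cmod z < r" for z
    proof (cases "z = a")
      case True
      have "(cmod a)\<^sup>2 < r\<^sup>2" using a(1) by (intro power_strict_mono) auto
      then have "complex_of_real (r\<^sup>2 - (cmod a)\<^sup>2) \<noteq> 0" by (metis diff_gt_0_iff_gt less_irrefl of_real_eq_0_iff)
      moreover have "of_real (r\<^sup>2) - cnj a * a = complex_of_real (r\<^sup>2 - (cmod a)\<^sup>2)"
        by (simp add: complex_norm_square mult.commute del: of_real_power)
      ultimately show ?thesis using True r(1) by (simp add: b_def)
    next
      case False
      then show ?thesis using b_le[of z] that by auto
    qed
    \<comment> \<open>All \<open>n\<close> copies of the zero are replaced at once, so the number of
      distinct zeros drops.\<close>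
    define h where "h z = g z * b z ^ n" for z
    have h: "h holomorphic_on ball 0 R"
      unfolding h_def b_def by (intro holomorphic_intros g(1)) (use r in auto)
    have h_nz: "h a \<noteq> 0" using g(2) b_nz a(1) by (simp add: h_def)
    have "?Z h \<subseteq> ?Z f - {a}"
      using h_nz b_nz g(3) r by (auto simp: h_def)
    moreover have "a \<in> ?Z f" using a by auto
    ultimately have "?Z h \<subset> ?Z f" by blast
    then have "card (?Z h) < card (?Z f)" using fin by (rule psubset_card_mono[rotated])
    from less.hyps[OF this h] obtain F where F: "F holomorphic_on ball 0 R"
        "\<forall>z\<in>ball 0 r. F z \<noteq> 0" "\<forall>z\<in>cball 0 r. cmod (h z) \<le> cmod (F z)"
        "\<forall>z\<in>sphere 0 r. cmod (h z) = cmod (F z)"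
      using h_nz aS by blast
    have "cmod (f z) \<le> cmod (h z)" if "cmod z \<le> r" for z
      using g(3)[of z] that r b_le[OF that]
      by (auto simp: h_def norm_mult norm_power mult.commute intro!: mult_left_mono power_mono)
    moreover have "cmod (f z) = cmod (h z)" if "cmod z = r" for z
      using g(3)[of z] that r b_eq[OF that] by (auto simp: h_def norm_mult norm_power)
    ultimately show ?thesis using F by (intro exI[of _ F]) force
  qed
qed

section \<open>Mean value inequalities on circles\<close>

text \<open>Cauchy's formula on the circle: for \<open>cmod z \<le> r / 2\<close> the kernel
  \<open>r / cmod (u - z)\<close> is at most 2.\<close>

lemma cmod_le_circle_mean:
  assumes F: "F holomorphic_on ball 0 R" and r: "0 < r" "r < R" and z: "cmod z \<le> r / 2"
  shows "cmod (F z) \<le> 2 * integral {0..1} (\<lambda>t. cmod (F (of_real r * cis (2 * pi * t))))"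
proof -
  have con: "continuous_on (cball 0 r) F"
    by (rule holomorphic_on_imp_continuous_on, rule holomorphic_on_subset[OF F]) (use r in auto)
  have "((\<lambda>u. F u / (u - z)) has_contour_integral (2 * of_real pi * \<i> * F z)) (circlepath 0 r)"
    by (rule Cauchy_integral_circlepath[OF con holomorphic_on_subset[OF F]]) (use r z in auto)
  then have 1: "((\<lambda>t. F (of_real r * cis (2 * pi * t)) / (of_real r * cis (2 * pi * t) - z) *
      (2 * pi * \<i> * r * cis (2 * pi * t))) has_integral (2 * of_real pi * \<i> * F z)) {0..1}"
    unfolding has_contour_integral_def
  proof (rule has_integral_eq[rotated])
    fix t :: real assume t: "t \<in> {0..1}"
    have e: "exp (2 * of_real pi * \<i> * of_real t) = cis (2 * pi * t)"
      by (simp add: cis_conv_exp mult_ac)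
    have v: "vector_derivative (circlepath 0 r) (at t within {0..1})
        = 2 * pi * \<i> * r * cis (2 * pi * t)"
      using vector_derivative_circlepath01[of t 0 r] t e by simp
    have c: "circlepath 0 r t = of_real r * cis (2 * pi * t)"
      by (simp only: circlepath e add_0)
    show "F (circlepath 0 r t) / (circlepath 0 r t - z) * vector_derivative (circlepath 0 r) (at t within {0..1})
      = F (of_real r * cis (2 * pi * t)) / (of_real r * cis (2 * pi * t) - z) *
        (2 * pi * \<i> * r * cis (2 * pi * t))"
      by (simp only: v c)
  qed
  have cont: "continuous_on {0..1} (\<lambda>t. cmod (F (of_real r * cis (2 * pi * t))))"
    by (intro continuous_on_norm continuous_on_compose2[OF con] continuous_intros)
       (use r in \<open>auto simp: norm_mult\<close>)
  have "cmod (2 * of_real pi * \<i> * F z) \<le>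
      integral {0..1} (\<lambda>t. 4 * pi * cmod (F (of_real r * cis (2 * pi * t))))"
    unfolding integral_unique[OF 1, symmetric]
  proof (rule integral_norm_bound_integral)
    show "(\<lambda>t. F (of_real r * cis (2 * pi * t)) / (of_real r * cis (2 * pi * t) - z) *
      (2 * pi * \<i> * r * cis (2 * pi * t))) integrable_on {0..1}" using 1 by blast
    show "(\<lambda>t. 4 * pi * cmod (F (of_real r * cis (2 * pi * t)))) integrable_on {0..1}"
      by (intro integrable_continuous_real continuous_intros cont)
    fix t :: real
    let ?u = "of_real r * cis (2 * pi * t)"
    have "r / 2 \<le> cmod (?u - z)"
      using norm_triangle_ineq2[of ?u z] z r by (simp add: norm_mult)
    moreover from this have "0 < cmod (?u - z)" using r by linarith
    ultimately have "r / cmod (?u - z) \<le> 2" by (simp add: pos_divide_le_eq)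
    then have "cmod (F ?u) * (r / cmod (?u - z)) \<le> cmod (F ?u) * 2"
      by (intro mult_left_mono) auto
    then have "2 * pi * (cmod (F ?u) * (r / cmod (?u - z))) \<le> 2 * pi * (cmod (F ?u) * 2)"
      by (rule mult_left_mono) simp
    moreover have "norm (F ?u / (?u - z) * (2 * pi * \<i> * r * cis (2 * pi * t)))
        = 2 * pi * (cmod (F ?u) * (r / cmod (?u - z)))"
      using r by (simp add: norm_mult norm_divide)
    ultimately show "norm (F ?u / (?u - z) * (2 * pi * \<i> * r * cis (2 * pi * t))) \<le> 4 * pi * cmod (F ?u)"
      by linarith
  qed
  then show ?thesis by (simp add: norm_mult)
qed

text \<open>Replacing \<open>f\<close> by the zero-free \<open>F\<close> does not lower the
  left-hand side and keeps the right-hand side. With a logarithm \<open>L\<close> of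
  \<open>F\<close>, the product \<open>|F|^a |H|\<close> is the modulus of the holomorphic function
  \<open>exp (a L) H\<close>.\<close>

lemma powr_cmod_le_circle_mean:
  fixes a :: real
  defines "P \<equiv> \<lambda>x. if a = 0 then 1 else x powr a" \<comment> \<open>because \<open>0 powr 0 = 0\<close>\<close>
  assumes f: "f holomorphic_on ball 0 R" and H: "H holomorphic_on ball 0 R"
    and r: "0 < r" "r < R" and z: "cmod z \<le> r / 4" and a: "0 \<le> a"
  shows "P (cmod (f z)) * cmod (H z) \<le> 2 * integral {0..1} (\<lambda>t.
    P (cmod (f (of_real r * cis (2 * pi * t)))) * cmod (H (of_real r * cis (2 * pi * t))))"
proof (cases "a = 0")
  case True
  then show ?thesis
    using cmod_le_circle_mean[OF H r, of z] z r by (simp add: P_def)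
next
  case False
  then have a: "0 < a" and P: "P = (\<lambda>x. x powr a)" using a by (auto simp: P_def)
  show ?thesis
  proof (cases "\<exists>z\<in>ball 0 R. f z \<noteq> 0")
    case False
    then have "f z = 0" using z r by auto
    \<comment> \<open>\<open>integral\<close> is 0 for a function that is not integrable, so it is
      nonnegative either way.\<close>
    moreover have "0 \<le> integral {0..1} (\<lambda>t. cmod (f (of_real r * cis (2 * pi * t))) powr a *
        cmod (H (of_real r * cis (2 * pi * t))))"
      by (cases "(\<lambda>t. cmod (f (of_real r * cis (2 * pi * t))) powr a *
        cmod (H (of_real r * cis (2 * pi * t)))) integrable_on {0..1}")
        (auto intro!: integral_nonneg simp: not_integrable_integral)
    ultimately show ?thesis by (simp add: P)
  next
    case True
    from blaschke_zero_removal[OF f r True] obtain F where F: "F holomorphic_on ball 0 R"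
      "\<And>z. z \<in> ball 0 r \<Longrightarrow> F z \<noteq> 0" "\<And>z. z \<in> cball 0 r \<Longrightarrow> cmod (f z) \<le> cmod (F z)"
      "\<And>z. z \<in> sphere 0 r \<Longrightarrow> cmod (f z) = cmod (F z)" by blast
    have sub: "ball 0 r \<subseteq> ball (0::complex) R" using r by auto
    obtain L where L: "L holomorphic_on ball 0 r" "\<And>z. z \<in> ball 0 r \<Longrightarrow> F z = exp (L z)"
      using contractible_imp_holomorphic_log[OF holomorphic_on_subset[OF F(1) sub]
         convex_imp_contractible[OF convex_ball] F(2)] by metis
    define G where "G z = exp (of_real a * L z) * H z" for z
    have G: "G holomorphic_on ball 0 r"
      unfolding G_def by (intro holomorphic_intros L holomorphic_on_subset[OF H sub])
    have G_eq: "cmod (G z) = cmod (F z) powr a * cmod (H z)" if "z \<in> ball 0 r" for z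
      using L(2)[OF that] by (simp add: G_def norm_mult powr_def)
    \<comment> \<open>\<open>F\<close> may vanish on the circle of radius \<open>r\<close>, so
      \<open>L\<close> lives on the open disk only. The bound is proved on circles of radius
      \<open>\<rho> < r\<close> and passes to \<open>r\<close> by continuity of
      \<open>\<Phi>\<close>; \<open>\<rho> \<ge> r / 2\<close> ensures
      \<open>r / 4 \<le> \<rho> / 2\<close>.\<close>
    define \<Phi> where "\<Phi> \<rho> = integral {0..1} (\<lambda>t. cmod (F (of_real \<rho> * cis (2 * pi * t))) powr a *
        cmod (H (of_real \<rho> * cis (2 * pi * t))))" for \<rho> :: real
    have con: "continuous_on (ball 0 R) F" "continuous_on (ball 0 R) H"
      using F(1) H by (auto intro: holomorphic_on_imp_continuous_on)
    have cont: "continuous_on {r/2..r} \<Phi>"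
      unfolding \<Phi>_def interval_cbox
      by (rule integral_continuous_on_param, unfold split_beta,
          intro continuous_intros continuous_on_powr' continuous_on_compose2[OF con(1)]
            continuous_on_compose2[OF con(2)])
         (use r a in \<open>auto simp: norm_mult\<close>)
    have le: "cmod (G z) \<le> 2 * \<Phi> \<rho>" if "\<rho> \<in> {r/2..<r}" for \<rho>
    proof -
      have "cmod (G z) \<le> 2 * integral {0..1} (\<lambda>t. cmod (G (of_real \<rho> * cis (2 * pi * t))))"
        by (rule cmod_le_circle_mean[OF G]) (use that r z in auto)
      also have "integral {0..1} (\<lambda>t. cmod (G (of_real \<rho> * cis (2 * pi * t)))) = \<Phi> \<rho>"
        unfolding \<Phi>_def by (rule integral_cong, rule G_eq) (use that r in \<open>auto simp: norm_mult\<close>)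
      finally show ?thesis .
    qed
    have "cmod (G z) \<le> 2 * \<Phi> r"
    proof (rule continuous_ge_on_closure[where f = "\<lambda>\<rho>. 2 * \<Phi> \<rho>"])
      show "continuous_on (closure {r/2..<r}) (\<lambda>\<rho>. 2 * \<Phi> \<rho>)" "r \<in> closure {r/2..<r}"
        using r cont by (auto intro: continuous_intros)
    qed (rule le)
    moreover have "P (cmod (f z)) * cmod (H z) \<le> cmod (G z)"
      using F(3)[of z] z r a by (subst G_eq) (auto simp: P intro!: mult_right_mono powr_mono2)
    moreover have "\<Phi> r = integral {0..1} (\<lambda>t.
        P (cmod (f (of_real r * cis (2 * pi * t)))) * cmod (H (of_real r * cis (2 * pi * t))))"
      unfolding \<Phi>_def P by (rule integral_cong) (use r in \<open>simp add: F(4) norm_mult\<close>)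
    ultimately show ?thesis by simp
  qed
qed

section \<open>Harnack's inequality and dominated quotients\<close>

text \<open>Schwarz's lemma for the Cayley transform of the right half-plane, centred at the value
  at \<open>a\<close>; 3 is the Harnack constant \<open>(1 + 1/2) / (1 - 1/2)\<close>.\<close>

lemma Re_nonneg_imp_cmod_le:
  assumes F: "F holomorphic_on ball a d" and Re: "\<And>z. z \<in> ball a d \<Longrightarrow> 0 \<le> Re (F z)"
    and z: "dist a z \<le> d / 2" and d: "0 < d"
  shows "cmod (F z) \<le> 3 * cmod (F a)"
proof (rule field_le_epsilon)
  fix e :: real assume e: "0 < e"
  \<comment> \<open>Adding a positive constant makes the real part positive, so that the Cayley transform is defined.\<close>
  define c where "c = F a + of_real (e / 4)"
  define G where "G u = F (a + of_real d * u) + of_real (e / 4)" for u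
  have in_ball: "a + of_real d * u \<in> ball a d" if "cmod u < 1" for u
    using that d by (simp add: dist_norm norm_mult)
  have pos: "0 < Re (G u)" if "cmod u < 1" for u
    using Re[OF in_ball[OF that]] e by (simp add: G_def)
  have Rc: "0 < Re c" using pos[of 0] by (simp add: G_def c_def)
  have nz: "G u + cnj c \<noteq> 0" if "cmod u < 1" for u
  proof
    assume "G u + cnj c = 0"
    then have "Re (G u + cnj c) = 0" by (simp only: zero_complex.sel)
    then show False using pos[OF that] Rc by simp
  qed
  define S where "S u = (G u - c) / (G u + cnj c)" for u
  have hG: "G holomorphic_on ball 0 1"
    unfolding G_def
    by (intro holomorphic_intros holomorphic_on_compose_gen[OF _ F, unfolded o_def])
       (use in_ball in auto)
  have hS: "S holomorphic_on ball 0 1"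
    unfolding S_def by (intro holomorphic_intros hG) (use nz in auto)
  have S1: "cmod (S u) < 1" if "cmod u < 1" for u
  proof -
    \<comment> \<open>A point of the right half-plane is closer to \<open>c\<close> than to its
      mirror image \<open>- cnj c\<close>.\<close>
    have "(cmod (G u + cnj c))\<^sup>2 - (cmod (G u - c))\<^sup>2 = 4 * Re (G u) * Re c"
      unfolding cmod_power2 by (simp add: power2_eq_square algebra_simps)
    also have "\<dots> > 0" using pos[OF that] Rc by simp
    finally have "cmod (G u - c) < cmod (G u + cnj c)"
      by (metis diff_gt_0_iff_gt norm_ge_zero power2_less_imp_less)
    then show ?thesis using nz[OF that] by (simp add: S_def norm_divide divide_less_eq)
  qed
  have S0: "S 0 = 0" by (simp add: S_def G_def c_def)
  define u where "u = (z - a) / of_real d"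
  have u: "cmod u \<le> 1 / 2" using z d by (simp add: u_def norm_divide dist_norm norm_minus_commute field_simps)
  have "cmod (S u) \<le> cmod u"
    using Schwarz_Lemma(1)[OF hS S0 S1, of u] u by simp
  then have "cmod (G u - c) \<le> cmod u * cmod (G u + cnj c)"
    using nz[of u] u by (simp add: S_def norm_divide field_simps)
  also have "\<dots> \<le> 1 / 2 * (cmod (G u) + cmod c)"
    using u norm_triangle_ineq[of "G u" "cnj c"] by (intro mult_mono) auto
  finally have "cmod (G u) \<le> 3 * cmod c"
    using norm_triangle_ineq2[of "G u" c] by simp
  moreover have "G u = F z + of_real (e / 4)" using d by (simp add: G_def u_def)
  \<comment> \<open>The shift by \<open>e / 4\<close> is paid three times at \<open>a\<close> and
    once at \<open>z\<close>, in total \<open>e\<close>.\<close>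
  ultimately have "cmod (F z) - e / 4 \<le> 3 * (cmod (F a) + e / 4)"
    using norm_triangle_ineq[of "F a" "of_real (e/4)"] norm_triangle_ineq4[of "F z + of_real (e/4)" "of_real (e/4)"] e
    by (simp add: c_def)
  then show "cmod (F z) \<le> 3 * cmod (F a) + e" by simp
qed

text \<open>A Harnack chain: the segment is walked in \<open>n\<close> equal steps of length at most
  \<open>d / 2\<close>, each costing a factor 3.\<close>

lemma Re_nonneg_imp_cmod_le_chain:
  assumes F: "F holomorphic_on T" and Re: "\<And>z. z \<in> T \<Longrightarrow> 0 \<le> Re (F z)" and d: "0 < d"
    and "\<And>p. p \<in> closed_segment x y \<Longrightarrow> ball p d \<subseteq> T" "dist x y \<le> of_nat n * (d / 2)"
  shows "cmod (F y) \<le> 3 ^ n * cmod (F x)"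
  using assms(4,5)
proof (induction n arbitrary: x)
  case 0
  then show ?case by simp
next
  case (Suc n)
  \<comment> \<open>\<open>q\<close> ends the first of \<open>Suc n\<close> equal steps, so
    \<open>n\<close> of them remain from \<open>q\<close> to \<open>y\<close>.\<close>
  define q where "q = x + of_real (1 / Suc n) * (y - x)"
  have q: "q \<in> closed_segment x y"
  proof -
    have "q = (1 - 1 / Suc n) *\<^sub>R x + (1 / Suc n) *\<^sub>R y"
      unfolding q_def scaleR_conv_of_real of_real_diff by (simp only: algebra_simps of_real_1 mult_1_left)
    then show ?thesis unfolding in_segment by (intro exI[of _ "1 / Suc n"]) auto
  qed
  have "dist x q = dist x y / Suc n"
    by (simp add: q_def dist_norm norm_mult norm_divide norm_minus_commute del: of_nat_Suc)
  also have "\<dots> \<le> d / 2" using Suc.prems(2) by (simp add: field_simps)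
  finally have 1: "dist x q \<le> d / 2" .
  have "y - q = of_real (1 - 1 / Suc n) * (y - x)"
    by (simp add: q_def algebra_simps)
  then have "dist q y = (1 - 1 / Suc n) * dist x y"
    by (simp only: dist_norm norm_mult norm_of_real norm_minus_commute[of q y] norm_minus_commute[of x y]) (simp add: field_simps)
  also have "\<dots> = n / Suc n * dist x y" by (simp add: field_simps)
  also have "\<dots> \<le> n / Suc n * (Suc n * (d / 2))"
    using Suc.prems(2) by (intro mult_left_mono) auto
  also have "\<dots> = n * (d / 2)" by simp
  finally have 2: "dist q y \<le> n * (d / 2)" .
  have bx: "ball x d \<subseteq> T" by (rule Suc.prems(1)) simp
  have "cmod (F q) \<le> 3 * cmod (F x)"
    by (rule Re_nonneg_imp_cmod_le[OF holomorphic_on_subset[OF F bx] _ 1 d]) (use bx Re in auto)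
  moreover have "cmod (F y) \<le> 3 ^ n * cmod (F q)"
  proof (rule Suc.IH[OF _ 2])
    fix p assume "p \<in> closed_segment q y"
    then have "p \<in> closed_segment x y" using q by (meson ends_in_segment(2) subset_closed_segment subsetD)
    then show "ball p d \<subseteq> T" by (rule Suc.prems(1))
  qed
  ultimately have "cmod (F y) \<le> 3 ^ n * (3 * cmod (F x))"
    by (meson mult_left_mono order_trans zero_le_numeral zero_le_power)
  then show ?case by simp
qed

lemma Re_nonneg_annulus_harnack:
  fixes \<rho> r1 r2 R :: real
  assumes "0 < \<rho>" "\<rho> < r1" "r1 \<le> r2" "r2 < R"
  obtains K where "1 \<le> K"
    "\<And>F z z'. F holomorphic_on {z. \<rho> < cmod z \<and> cmod z < R} \<Longrightarrow>
      (\<And>z. \<rho> < cmod z \<Longrightarrow> cmod z < R \<Longrightarrow> 0 \<le> Re (F z)) \<Longrightarrow>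
      r1 \<le> cmod z \<Longrightarrow> cmod z \<le> r2 \<Longrightarrow> r1 \<le> cmod z' \<Longrightarrow> cmod z' \<le> r2 \<Longrightarrow>
      cmod (F z) \<le> K * cmod (F z')"
proof -
  \<comment> \<open>\<open>d\<close> is the distance from the closed strip
    \<open>ln r1 \<le> Re x \<le> ln r2\<close> to the boundary of the open strip lying over the
    whole annulus.\<close>
  define d where "d = min (ln r1 - ln \<rho>) (ln R - ln r2)"
  have d: "0 < d" using assms by (simp add: d_def)
  \<comment> \<open>Principal logarithms of two points of the closed annulus differ by at most
    \<open>ln r2 - ln r1\<close> in the real part and \<open>2 * pi\<close> in the imaginary part;
    \<open>n\<close> steps of length \<open>d / 2\<close> cover that.\<close>
  obtain n :: nat where n: "ln r2 - ln r1 + 2 * pi \<le> n * (d / 2)"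
    using d by (metis ex_less_of_nat_mult half_gt_zero less_imp_le)
  \<comment> \<open>The exponential map pulls the annulus back to a convex strip, where the chain lemma applies.\<close>
  define T where "T = {x. ln \<rho> < Re x \<and> Re x < ln R}"
  show thesis
  proof (rule that[of "3 ^ n"])
    fix F z z'
    assume F: "F holomorphic_on {z. \<rho> < cmod z \<and> cmod z < R}"
      and Re: "\<And>z. \<rho> < cmod z \<Longrightarrow> cmod z < R \<Longrightarrow> 0 \<le> Re (F z)"
      and z: "r1 \<le> cmod z" "cmod z \<le> r2" "r1 \<le> cmod z'" "cmod z' \<le> r2"
    have z0: "z \<noteq> 0" "z' \<noteq> 0" using z assms by auto
    define C where "C = {x. Re x \<ge> ln r1} \<inter> {x. Re x \<le> ln r2}"
    have C: "convex C" unfolding C_def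
      by (intro convex_Int convex_halfspace_Re_ge convex_halfspace_Re_le)
    have ZC: "Ln z \<in> C" "Ln z' \<in> C"
      using z z0 assms by (auto simp: C_def)
    have T: "\<rho> < cmod (exp x) \<and> cmod (exp x) < R" if "x \<in> T" for x
    proof -
      have "exp (ln \<rho>) < exp (Re x) \<and> exp (Re x) < exp (ln R)" using that by (simp add: T_def)
      then show ?thesis using assms by simp
    qed
    have "cmod ((F \<circ> exp) (Ln z)) \<le> 3 ^ n * cmod ((F \<circ> exp) (Ln z'))"
    proof (rule Re_nonneg_imp_cmod_le_chain[where T = T and F = "F \<circ> exp", OF _ _ d])
      show "F \<circ> exp holomorphic_on T"
        by (rule holomorphic_on_compose_gen[OF holomorphic_on_exp F]) (use T in blast)
      show "0 \<le> Re ((F \<circ> exp) x)" if "x \<in> T" for x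
        using Re T[OF that] by simp
      fix p assume "p \<in> closed_segment (Ln z') (Ln z)"
      then have "p \<in> C" using closed_segment_subset[OF ZC(2,1) C] by blast
      then have p: "ln r1 \<le> Re p" "Re p \<le> ln r2" by (auto simp: C_def)
      show "ball p d \<subseteq> T"
      proof
        fix x assume "x \<in> ball p d"
        then have "\<bar>Re p - Re x\<bar> < d"
          using abs_Re_le_cmod[of "p - x"] by (simp add: dist_norm)
        then show "x \<in> T" using p by (auto simp: T_def d_def)
      qed
    next
      have "dist (Ln z') (Ln z) \<le> \<bar>Re (Ln z' - Ln z)\<bar> + \<bar>Im (Ln z' - Ln z)\<bar>"
        unfolding dist_norm by (rule cmod_le)
      also have "\<bar>Re (Ln z' - Ln z)\<bar> \<le> ln r2 - ln r1"
        using ZC by (auto simp: C_def)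
      also have "\<bar>Im (Ln z' - Ln z)\<bar> \<le> 2 * pi"
        using Im_Ln_le_pi[OF z0(1)] Im_Ln_le_pi[OF z0(2)] mpi_less_Im_Ln[OF z0(1)] mpi_less_Im_Ln[OF z0(2)]
        by auto
      finally show "dist (Ln z') (Ln z) \<le> real n * (d / 2)" using n by simp
    qed
    then show "cmod (F z) \<le> 3 ^ n * cmod (F z')" using z0 by simp
  qed simp
qed

section \<open>Quotients of modulus at most one\<close>

text \<open>The zeros of \<open>g\<close> are isolated because \<open>S\<close> is connected, and
  near them \<open>f / g\<close> is bounded by 1, so Riemann's theorem removes the
  singularities.\<close>

lemma dominated_quotient_extends:
  assumes f: "f holomorphic_on S" and g: "g holomorphic_on S" and S: "open S" "connected S"
    and nz: "\<exists>z\<in>S. g z \<noteq> 0" and le: "\<And>z. z \<in> S \<Longrightarrow> cmod (f z) \<le> cmod (g z)"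
  obtains h where "h holomorphic_on S" "\<And>z. z \<in> S \<Longrightarrow> cmod (h z) \<le> 1"
    "\<And>z. z \<in> S \<Longrightarrow> f z = h z * g z"
proof -
  define q where "q z = f z / g z" for z
  \<comment> \<open>\<open>q\<close> takes the value 0 at the zeros of \<open>g\<close>, as division
    by zero yields 0; \<open>remove_sings\<close> puts the limit there instead.\<close>
  define h where "h = remove_sings q"
  have *: "h analytic_on {z} \<and> cmod (h z) \<le> 1" if z: "z \<in> S" for z
  proof -
    have "\<forall>\<^sub>F w in at z. g w \<noteq> 0 \<and> w \<in> S"
      using non_zero_neighbour_alt[OF g S z] nz by blast
    then obtain r where r: "0 < r" "\<And>w. w \<in> ball z r \<Longrightarrow> w \<noteq> z \<Longrightarrow> g w \<noteq> 0 \<and> w \<in> S"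
      unfolding eventually_at by (auto simp: dist_commute)
    have q1: "cmod (q w) \<le> 1" if "w \<in> ball z r - {z}" for w
      using le[of w] r(2)[of w] that by (auto simp: q_def norm_divide)
    have qh: "q holomorphic_on ball z r - {z}"
      unfolding q_def
      by (intro holomorphic_intros holomorphic_on_subset[OF f] holomorphic_on_subset[OF g])
         (use r(2) in force)+
    have ev: "\<forall>\<^sub>F w in at z. w \<in> ball z r - {z}"
      using r(1) eventually_at_in_open[of "ball z r" z] by simp
    then have "\<forall>\<^sub>F w in at z. cmod (q w) \<le> 1"
      by eventually_elim (rule q1)
    then obtain e where e: "e holomorphic_on ball z r" "\<And>w. w \<in> ball z r - {z} \<Longrightarrow> e w = q w"
      using holomorphic_on_extend_bounded[OF qh] r(1) by (metis centre_in_ball interior_ball)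
    have "e \<midarrow>z\<rightarrow> e z"
      using holomorphic_on_imp_continuous_on[OF e(1)] r(1)
      by (simp add: continuous_on_eq_continuous_at isCont_def)
    then have lim: "q \<midarrow>z\<rightarrow> e z"
      by (rule Lim_transform_eventually) (use ev e(2) in \<open>auto elim: eventually_mono\<close>)
    have "isolated_singularity_at q z"
      by (rule isolated_singularity_at_holomorphic[OF qh]) (use r in auto)
    then have "h analytic_on {z}" unfolding h_def using lim by (rule remove_sings_analytic_at)
    moreover have "h z = e z" unfolding h_def using lim by (rule remove_sings_eqI)
    moreover have "cmod (e z) \<le> 1"
      by (rule tendsto_upperbound[OF tendsto_norm[OF lim]])
         (use ev q1 in \<open>auto elim: eventually_mono\<close>)
    ultimately show ?thesis by simp
  qed
  show thesis
  proof (rule that)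
    have "h analytic_on S" using * analytic_on_analytic_at by blast
    then show "h holomorphic_on S" by (rule analytic_imp_holomorphic)
    show "cmod (h z) \<le> 1" if "z \<in> S" for z using * that by blast
    show "f z = h z * g z" if z: "z \<in> S" for z
    proof (cases "g z = 0")
      case True
      then show ?thesis using le[OF z] by simp
    next
      case False
      have "q analytic_on {z}"
      proof -
        have "f analytic_on {z}" "g analytic_on {z}"
          using f g S(1) z by (meson analytic_at)+
        then show ?thesis unfolding q_def using False by (intro analytic_intros) auto
      qed
      then have "h z = q z" by (simp add: h_def)
      then show ?thesis using False by (simp add: q_def)
    qed
  qed
qed

lemma unimodular_phase: "\<exists>u. cmod u = 1 \<and> cnj u * z = of_real (cmod z)"
proof (cases "z = 0")
  case False
  have "cnj (z / of_real (cmod z)) * z = (z * cnj z) / of_real (cmod z)"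
    by (simp add: mult.commute)
  also have "\<dots> = of_real (cmod z)"
    using False by (simp only: complex_norm_square[symmetric]) (simp add: power2_eq_square)
  finally show ?thesis using False by (intro exI[of _ "z / of_real (cmod z)"]) (auto simp: norm_divide)
qed (auto intro: exI[of _ 1])

text \<open>Where \<open>h = f / g\<close> has modulus close to 1 it is nearly constant: Harnack for
  \<open>1 - cnj u * h\<close> carries closeness to a unimodular \<open>u\<close> from one point to
  the whole closed annulus. Using Harnack twice gives \<open>C = K * K\<close>.\<close>

lemma dominated_phase_bound:
  fixes \<rho> r1 r2 R :: real
  assumes "0 < \<rho>" "\<rho> < r1" "r1 \<le> r2" "r2 < R"
  obtains C where "1 \<le> C"
    "\<And>f g. f holomorphic_on {z. \<rho> < cmod z \<and> cmod z < R} \<Longrightarrow>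
      g holomorphic_on {z. \<rho> < cmod z \<and> cmod z < R} \<Longrightarrow>
      (\<And>z. \<rho> < cmod z \<Longrightarrow> cmod z < R \<Longrightarrow> cmod (f z) \<le> cmod (g z)) \<Longrightarrow>
      \<exists>u. cmod u = 1 \<and> (\<forall>z. r1 \<le> cmod z \<longrightarrow> cmod z \<le> r2 \<longrightarrow>
        cmod (f z - u * g z) \<le> C * (cmod (g z) - cmod (f z)))"
proof -
  define S where "S = {z. \<rho> < cmod z \<and> cmod z < R}"
  have S: "open S" "connected S"
    unfolding S_def using connected_annulus(1)[of \<rho> "0::complex" R]
    by (auto intro!: open_Collect_conj open_Collect_less continuous_intros)
  obtain K where K: "1 \<le> K"
    "\<And>F z z'. F holomorphic_on S \<Longrightarrow> (\<And>z. z \<in> S \<Longrightarrow> 0 \<le> Re (F z)) \<Longrightarrow>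
      r1 \<le> cmod z \<Longrightarrow> cmod z \<le> r2 \<Longrightarrow> r1 \<le> cmod z' \<Longrightarrow> cmod z' \<le> r2 \<Longrightarrow>
      cmod (F z) \<le> K * cmod (F z')"
    using Re_nonneg_annulus_harnack[OF assms] unfolding S_def by (metis (mono_tags, lifting) mem_Collect_eq)
  show thesis
  proof (rule that[of "K * K"])
    show "1 \<le> K * K" using mult_mono[OF K(1) K(1)] K(1) by simp
    fix f g
    assume f: "f holomorphic_on {z. \<rho> < cmod z \<and> cmod z < R}"
      and g: "g holomorphic_on {z. \<rho> < cmod z \<and> cmod z < R}"
      and le: "\<And>z. \<rho> < cmod z \<Longrightarrow> cmod z < R \<Longrightarrow> cmod (f z) \<le> cmod (g z)"
    have le': "cmod (f z) \<le> cmod (g z)" if "z \<in> S" for z using le that by (auto simp: S_def)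
    have inS: "z \<in> S" if "r1 \<le> cmod z" "cmod z \<le> r2" for z
      using that assms by (auto simp: S_def)
    show "\<exists>u. cmod u = 1 \<and> (\<forall>z. r1 \<le> cmod z \<longrightarrow> cmod z \<le> r2 \<longrightarrow>
        cmod (f z - u * g z) \<le> K * K * (cmod (g z) - cmod (f z)))"
    proof (cases "\<exists>z\<in>S. g z \<noteq> 0")
      case False
      then have "f z = 0 \<and> g z = 0" if "z \<in> S" for z using le'[OF that] that by auto
      then show ?thesis using inS by (intro exI[of _ 1]) auto
    next
      case True
      obtain h where h: "h holomorphic_on S" "\<And>z. z \<in> S \<Longrightarrow> cmod (h z) \<le> 1"
          "\<And>z. z \<in> S \<Longrightarrow> f z = h z * g z"
        using dominated_quotient_extends[OF f[folded S_def] g[folded S_def] S True le'] by metis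
      have harnack: "cmod (1 - cnj u * h z) \<le> K * cmod (1 - cnj u * h z')"
        if u: "cmod u = 1" and z: "r1 \<le> cmod z" "cmod z \<le> r2" "r1 \<le> cmod z'" "cmod z' \<le> r2" for u z z'
      proof (rule K(2)[OF _ _ z])
        show "(\<lambda>z. 1 - cnj u * h z) holomorphic_on S" by (intro holomorphic_intros h)
        fix z assume "z \<in> S"
        then have "cmod (cnj u * h z) \<le> 1" using h(2) u by (simp add: norm_mult)
        then show "0 \<le> Re (1 - cnj u * h z)"
          using complex_Re_le_cmod[of "cnj u * h z"] by simp
      qed
      \<comment> \<open>A base point of the closed annulus; the phase of \<open>h\<close> there
        fixes \<open>u\<close> for all \<open>z\<close>.\<close>
      define z0 where "z0 = complex_of_real r1"
      have z0: "r1 \<le> cmod z0" "cmod z0 \<le> r2" using assms by (auto simp: z0_def)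
      obtain u where u: "cmod u = 1" "cnj u * h z0 = of_real (cmod (h z0))"
        using unimodular_phase by blast
      \<comment> \<open>With this phase \<open>cnj u * h z0\<close> is a real number between 0 and
        1.\<close>
      have at0: "cmod (1 - cnj u * h z0) = 1 - cmod (h z0)"
        using h(2)[OF inS[OF z0]] unfolding u(2) by (metis abs_of_nonneg diff_ge_0_iff_ge norm_of_real of_real_1 of_real_diff)
      have "cmod (f z - u * g z) \<le> K * K * (cmod (g z) - cmod (f z))"
        if z: "r1 \<le> cmod z" "cmod z \<le> r2" for z
      proof -
        \<comment> \<open>Harnack with the phase of \<open>h z\<close> bounds \<open>1 - |h z0|\<close> by \<open>1 - |h z|\<close>; with the phase
          of \<open>h z0\<close> it bounds \<open>|u - h z|\<close> by \<open>1 - |h z0|\<close>.\<close>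
        obtain v where v: "cmod v = 1" "cnj v * h z = of_real (cmod (h z))"
          using unimodular_phase by blast
        have at: "cmod (1 - cnj v * h z) = 1 - cmod (h z)"
          using h(2)[OF inS[OF z]] unfolding v(2) by (metis abs_of_nonneg diff_ge_0_iff_ge norm_of_real of_real_1 of_real_diff)
        have "1 - cmod (h z0) \<le> cmod (1 - cnj v * h z0)"
          using norm_triangle_ineq2[of 1 "cnj v * h z0"] v(1) by (simp add: norm_mult)
        also have "\<dots> \<le> K * (1 - cmod (h z))"
          using harnack[OF v(1) z0 z] at by simp
        finally have "K * (1 - cmod (h z0)) \<le> K * (K * (1 - cmod (h z)))"
          using K(1) by (intro mult_left_mono) auto
        with harnack[OF u(1) z z0] at0
        have *: "cmod (1 - cnj u * h z) \<le> K * K * (1 - cmod (h z))" by simp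
        have "u * cnj u = 1" using complex_norm_square[of u] u(1) by simp
        then have "u - h z = u * (1 - cnj u * h z)"
          by (simp add: right_diff_distrib flip: mult.assoc)
        then have "cmod (u - h z) = cmod (1 - cnj u * h z)" using u(1) by (simp add: norm_mult)
        moreover have "f z - u * g z = - (u - h z) * g z"
          using h(3)[OF inS[OF z]] by (simp add: algebra_simps)
        ultimately have "cmod (f z - u * g z) = cmod (1 - cnj u * h z) * cmod (g z)"
          by (simp add: norm_mult norm_minus_commute)
        also have "\<dots> \<le> K * K * (1 - cmod (h z)) * cmod (g z)"
          by (intro mult_right_mono *) auto
        also have "\<dots> = K * K * (cmod (g z) - cmod (f z))"
          using h(3)[OF inS[OF z]] by (simp add: norm_mult algebra_simps)
        finally show ?thesis .
      qed
      then show ?thesis using u(1) by blast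
    qed
  qed
qed

section \<open>Pointwise domination by circle means\<close>

text \<open>Mean value theorem: the slope at a point below \<open>x\<close> is at most the slope at
  \<open>x\<close>, as \<open>p - 1 \<ge> 0\<close>. For \<open>x \<le> y\<close> the left-hand side
  is not positive.\<close>

lemma powr_diff_le:
  fixes x y p :: real
  assumes p: "1 \<le> p" and xy: "0 \<le> x" "0 \<le> y"
  shows "x powr p - y powr p \<le> p * (if p - 1 = 0 then 1 else x powr (p - 1)) * \<bar>x - y\<bar>"
proof (cases "x \<le> y")
  case True
  then have "x powr p \<le> y powr p" using xy p by (intro powr_mono2) auto
  moreover have "0 \<le> p * (if p - 1 = 0 then 1 else x powr (p - 1)) * \<bar>x - y\<bar>" using p by simp
  ultimately show ?thesis by linarith
next
  case False
  then have yx: "y < x" by simp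
  have "\<exists>l z. y < z \<and> z < x \<and> ((\<lambda>t. t powr p) has_real_derivative l) (at z) \<and>
      x powr p - y powr p = (x - y) * l"
  proof (rule MVT[OF yx])
    show "continuous_on {y..x} (\<lambda>t. t powr p)"
      using xy p by (intro continuous_on_powr' continuous_intros) auto
    show "(\<lambda>t. t powr p) differentiable (at z)" if "y < z" "z < x" for z
      unfolding real_differentiable_def using that xy has_real_derivative_powr[of z p] by auto
  qed
  then obtain l z where z: "y < z" "z < x" "((\<lambda>t. t powr p) has_real_derivative l) (at z)"
      "x powr p - y powr p = (x - y) * l" by blast
  have "l = p * z powr (p - 1)"
    using DERIV_unique[OF z(3) has_real_derivative_powr] z(1) xy by simp
  moreover have "z powr (p - 1) \<le> (if p - 1 = 0 then 1 else x powr (p - 1))"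
    using z xy p by (auto intro: powr_mono2)
  ultimately have "l \<le> p * (if p - 1 = 0 then 1 else x powr (p - 1))"
    using p by (auto intro!: mult_left_mono)
  then have "(x - y) * l \<le> (x - y) * (p * (if p - 1 = 0 then 1 else x powr (p - 1)))"
    using yx by (intro mult_left_mono) auto
  then show ?thesis using z(4) yx by (simp add: mult_ac)
qed

text \<open>A converse to \<open>powr_diff_le\<close> with the same factor in \<open>x\<close>:
  \<open>y powr p = y powr (p - 1) * y\<close> is at least
  \<open>x powr (p - 1) * y\<close>.\<close>

lemma powr_diff_ge:
  fixes x y p :: real
  assumes "1 \<le> p" "0 \<le> x" "x \<le> y"
  shows "(if p - 1 = 0 then 1 else x powr (p - 1)) * (y - x) \<le> y powr p - x powr p"
proof (cases "p = 1 \<or> x = 0")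
  case True
  then show ?thesis using assms by auto
next
  case False
  then have *: "t powr p = t powr (p - 1) * t" if "0 < t" for t
    using that by (simp add: powr_diff)
  have "x powr (p - 1) * y \<le> y powr (p - 1) * y"
    using assms by (intro mult_right_mono powr_mono2) auto
  then show ?thesis using False assms by (simp add: * algebra_simps)
qed

lemma domination_circle_mean:
  fixes r1 r2 p :: real
  assumes r: "0 < r1" "r1 \<le> r2" "r2 < 1" and p: "1 \<le> p"
  obtains M where "0 < M"
    "\<And>f g z \<zeta>. f holomorphic_on ball 0 1 \<Longrightarrow> g holomorphic_on ball 0 1 \<Longrightarrow>
      (\<And>z. r1 / 4 \<le> cmod z \<Longrightarrow> cmod z < 1 \<Longrightarrow> cmod (f z) \<le> cmod (g z)) \<Longrightarrow>
      cmod z \<le> r1 / 4 \<Longrightarrow> r1 \<le> cmod \<zeta> \<Longrightarrow> cmod \<zeta> \<le> r2 \<Longrightarrow>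
      cmod (f z) powr p - cmod (g z) powr p \<le> M * integral {0..1} (\<lambda>t.
        cmod (g (\<zeta> * cis (2 * pi * t))) powr p - cmod (f (\<zeta> * cis (2 * pi * t))) powr p)"
proof -
  \<comment> \<open>Domination from radius \<open>r1 / 4\<close> on covers the annulus from
    \<open>r1 / 2\<close> to 1, which leaves Harnack room on both sides of the closed
    annulus.\<close>
  obtain C where C: "1 \<le> C"
    "\<And>f g. f holomorphic_on {z. r1 / 2 < cmod z \<and> cmod z < 1} \<Longrightarrow>
      g holomorphic_on {z. r1 / 2 < cmod z \<and> cmod z < 1} \<Longrightarrow>
      (\<And>z. r1 / 2 < cmod z \<Longrightarrow> cmod z < 1 \<Longrightarrow> cmod (f z) \<le> cmod (g z)) \<Longrightarrow>
      \<exists>u. cmod u = 1 \<and> (\<forall>z. r1 \<le> cmod z \<longrightarrow> cmod z \<le> r2 \<longrightarrow>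
        cmod (f z - u * g z) \<le> C * (cmod (g z) - cmod (f z)))"
    by (rule dominated_phase_bound[of "r1/2" r1 r2 1]) (use r in auto)
  define P where "P x = (if p - 1 = 0 then 1 else x powr (p - 1))" for x :: real
  have P0: "0 \<le> P x" for x by (simp add: P_def)
  show thesis
  \<comment> \<open>The factor \<open>p\<close> comes from the mean value theorem, 2 from the circle
    mean and \<open>C\<close> from the phase bound.\<close>
  proof (rule that[of "2 * p * C"])
    show "0 < 2 * p * C" using C(1) p by simp
    fix f g :: "complex \<Rightarrow> complex" and z \<zeta> :: complex
    assume f0: "f holomorphic_on ball 0 1" and g0: "g holomorphic_on ball 0 1"
      and le0: "\<And>z. r1 / 4 \<le> cmod z \<Longrightarrow> cmod z < 1 \<Longrightarrow> cmod (f z) \<le> cmod (g z)"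
      and z: "cmod z \<le> r1 / 4" and \<zeta>: "r1 \<le> cmod \<zeta>" "cmod \<zeta> \<le> r2"
    define s where "s = cmod \<zeta>"
    \<comment> \<open>Rotation by \<open>v\<close> carries the positive real \<open>s\<close> to
      \<open>\<zeta>\<close>, so the circle through \<open>\<zeta>\<close> gets the parametrisation
      used in the mean value inequalities.\<close>
    define v where "v = \<zeta> / of_real s"
    have s: "0 < s" "s < 1" using \<zeta> r by (auto simp: s_def)
    have v: "cmod v = 1" "of_real s * v = \<zeta>" "v \<noteq> 0"
      using s by (auto simp: v_def norm_divide s_def)
    define F G where "F w = f (v * w)" and "G w = g (v * w)" for w
    have F: "F holomorphic_on ball 0 1" and G: "G holomorphic_on ball 0 1"
      unfolding F_def G_def using v(1)
      by (auto intro!: holomorphic_on_compose_gen[OF _ f0, unfolded o_def]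
          holomorphic_on_compose_gen[OF _ g0, unfolded o_def] holomorphic_intros simp: norm_mult)
    have le: "cmod (F w) \<le> cmod (G w)" if "r1 / 4 \<le> cmod w" "cmod w < 1" for w
      using le0[of "v * w"] that v(1) by (simp add: F_def G_def norm_mult)
    have sub: "{z::complex. r1 / 2 < cmod z \<and> cmod z < 1} \<subseteq> ball 0 1" by auto
    obtain u where u: "cmod u = 1" "\<And>z. r1 \<le> cmod z \<Longrightarrow> cmod z \<le> r2 \<Longrightarrow>
        cmod (F z - u * G z) \<le> C * (cmod (G z) - cmod (F z))"
      using C(2)[OF holomorphic_on_subset[OF F sub] holomorphic_on_subset[OF G sub]] le r by force
    define H where "H w = F w - u * G w" for w
    have H: "H holomorphic_on ball 0 1" unfolding H_def by (intro holomorphic_intros F G)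
    define c where "c t = of_real s * cis (2 * pi * t)" for t
    have cs: "cmod (c t) = s" for t using s by (simp add: c_def norm_mult)
    have con: "continuous_on (ball 0 1) F" "continuous_on (ball 0 1) G" "continuous_on (ball 0 1) H"
      using F G H by (auto intro: holomorphic_on_imp_continuous_on)
    have contP: "continuous_on {0..1} (\<lambda>t. P (cmod (F (c t))))"
    proof (cases "p = 1")
      case False
      then show ?thesis
        unfolding P_def c_def
        by (simp only: diff_eq_eq add_0 if_False,
            intro continuous_intros continuous_on_powr' continuous_on_compose2[OF con(1)])
          (use s p False in \<open>auto simp: norm_mult\<close>)
    qed (simp add: P_def)
    have cont: "continuous_on {0..1} (\<lambda>t. cmod (H (c t)))"
       "continuous_on {0..1} (\<lambda>t. cmod (G (c t)) powr p - cmod (F (c t)) powr p)"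
      unfolding c_def
      by (intro continuous_intros continuous_on_powr' continuous_on_compose2[OF con(1)]
            continuous_on_compose2[OF con(2)] continuous_on_compose2[OF con(3)];
          use s p in \<open>auto simp: norm_mult\<close>)+
    \<comment> \<open>The point \<open>z\<close> in rotated coordinates;
      \<open>cmod z \<le> r1 / 4 \<le> s / 4\<close> puts it in the range of the circle mean
      bound.\<close>
    define w where "w = z / v"
    have w: "cmod w \<le> s / 4" "v * w = z" using v z \<zeta> by (auto simp: w_def norm_divide s_def)
    have "cmod (F w) powr p - cmod (G w) powr p \<le> p * P (cmod (F w)) * \<bar>cmod (F w) - cmod (G w)\<bar>"
      unfolding P_def by (rule powr_diff_le[OF p]) auto
    also have "\<bar>cmod (F w) - cmod (G w)\<bar> \<le> cmod (H w)"
      using norm_triangle_ineq3[of "F w" "u * G w"] u(1) by (simp add: H_def norm_mult)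
    also have "p * P (cmod (F w)) * cmod (H w) = p * (P (cmod (F w)) * cmod (H w))" by simp
    also have "P (cmod (F w)) * cmod (H w) \<le> 2 * integral {0..1} (\<lambda>t. P (cmod (F (c t))) * cmod (H (c t)))"
      unfolding P_def c_def by (rule powr_cmod_le_circle_mean[OF F H s w(1)]) (use p in simp)
    also have "integral {0..1} (\<lambda>t. P (cmod (F (c t))) * cmod (H (c t))) \<le>
        integral {0..1} (\<lambda>t. C * (cmod (G (c t)) powr p - cmod (F (c t)) powr p))"
    proof (rule integral_le)
      fix t :: real
      \<comment> \<open>On the circle \<open>|H|\<close> is at most \<open>C\<close> times the gap
        between the moduli, and the factor \<open>P\<close> turns that gap into a gap between p-th
        powers.\<close>
      have "P (cmod (F (c t))) * cmod (H (c t)) \<le> P (cmod (F (c t))) * (C * (cmod (G (c t)) - cmod (F (c t))))"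
        unfolding H_def using u(2)[of "c t"] \<zeta> cs[of t] by (intro mult_left_mono P0) (auto simp: s_def)
      also have "\<dots> = C * (P (cmod (F (c t))) * (cmod (G (c t)) - cmod (F (c t))))" by simp
      also have "\<dots> \<le> C * (cmod (G (c t)) powr p - cmod (F (c t)) powr p)"
        unfolding P_def using C(1) \<zeta> s cs[of t] r by (intro mult_left_mono powr_diff_ge p le) (auto simp: s_def)
      finally show "P (cmod (F (c t))) * cmod (H (c t)) \<le> C * (cmod (G (c t)) powr p - cmod (F (c t)) powr p)" .
    qed (intro integrable_continuous_real continuous_intros contP cont)+
    finally have "cmod (F w) powr p - cmod (G w) powr p \<le>
        2 * p * C * integral {0..1} (\<lambda>t. cmod (G (c t)) powr p - cmod (F (c t)) powr p)"
      using p P0 by (simp add: mult_left_mono)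
    moreover have "v * c t = \<zeta> * cis (2 * pi * t)" for t
      by (simp add: c_def v(2)[symmetric])
    ultimately show "cmod (f z) powr p - cmod (g z) powr p \<le> 2 * p * C * integral {0..1} (\<lambda>t.
        cmod (g (\<zeta> * cis (2 * pi * t))) powr p - cmod (f (\<zeta> * cis (2 * pi * t))) powr p)"
      by (simp add: F_def G_def w(2))
  qed
qed

section \<open>Rotation invariance of Lebesgue measure\<close>

lemma borel_measurable_Complex [measurable]:
  assumes [measurable]: "f \<in> borel_measurable M" "g \<in> borel_measurable M"
  shows "(\<lambda>x. Complex (f x) (g x)) \<in> borel_measurable M"
  unfolding Complex_eq by measurable

text \<open>It is enough to compare boxes, where both measures give the product of the side lengths.
  This opens the way to Fubini in real and imaginary parts.\<close>

lemma lborel_complex_eq_distr: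
  "(lborel :: complex measure) = distr (lborel \<Otimes>\<^sub>M lborel) borel (\<lambda>(x, y). Complex x y)"
proof (rule lborel_eqI)
  have [measurable]: "(\<lambda>(x, y). Complex x y) \<in> borel_measurable (lborel \<Otimes>\<^sub>M lborel)"
    unfolding split_beta by measurable
  fix l u :: complex assume *: "\<And>b. b \<in> Basis \<Longrightarrow> l \<bullet> b \<le> u \<bullet> b"
  then have le: "Re l \<le> Re u" "Im l \<le> Im u" using *[of 1] *[of \<i>] by (auto simp: Basis_complex_def)
  have "emeasure (distr (lborel \<Otimes>\<^sub>M lborel) borel (\<lambda>(x, y). Complex x y)) (box l u)
     = emeasure (lborel \<Otimes>\<^sub>M lborel) ((\<lambda>(x, y). Complex x y) -` box l u \<inter> space (lborel \<Otimes>\<^sub>M lborel))"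
    by (rule emeasure_distr) auto
  also have "(\<lambda>(x, y). Complex x y) -` box l u \<inter> space (lborel \<Otimes>\<^sub>M lborel)
     = box (Re l) (Re u) \<times> box (Im l) (Im u)"
    by (auto simp: box_def Basis_complex_def space_pair_measure)
  also have "emeasure (lborel \<Otimes>\<^sub>M lborel) \<dots> = (\<Prod>b\<in>Basis. (u - l) \<bullet> b)"
    using le by (subst lborel.emeasure_pair_measure_Times) (auto simp: Basis_complex_def ennreal_mult)
  finally show "emeasure (distr (lborel \<Otimes>\<^sub>M lborel) borel (\<lambda>(x, y). Complex x y)) (box l u)
     = (\<Prod>b\<in>Basis. (u - l) \<bullet> b)" .
qed simp

lemma nn_integral_lborel_complex:
  fixes f :: "complex \<Rightarrow> ennreal"
  assumes [measurable]: "f \<in> borel_measurable borel"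
  shows "(\<integral>\<^sup>+z. f z \<partial>lborel) = (\<integral>\<^sup>+x. \<integral>\<^sup>+y. f (Complex x y) \<partial>lborel \<partial>lborel)"
    and "(\<integral>\<^sup>+z. f z \<partial>lborel) = (\<integral>\<^sup>+y. \<integral>\<^sup>+x. f (Complex x y) \<partial>lborel \<partial>lborel)"
proof -
  have [measurable]: "(\<lambda>(x, y). Complex x y) \<in> borel_measurable (lborel \<Otimes>\<^sub>M lborel)"
    unfolding split_beta by measurable
  have m: "(\<lambda>q. f (Complex (fst q) (snd q))) \<in> borel_measurable (lborel \<Otimes>\<^sub>M lborel)"
    by measurable
  have *: "(\<integral>\<^sup>+z. f z \<partial>lborel) = (\<integral>\<^sup>+q. f (Complex (fst q) (snd q)) \<partial>(lborel \<Otimes>\<^sub>M lborel))"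
    by (subst lborel_complex_eq_distr, subst nn_integral_distr) (auto simp: split_beta)
  show "(\<integral>\<^sup>+z. f z \<partial>lborel) = (\<integral>\<^sup>+x. \<integral>\<^sup>+y. f (Complex x y) \<partial>lborel \<partial>lborel)"
    unfolding * using lborel.nn_integral_fst[OF m] by simp
  show "(\<integral>\<^sup>+z. f z \<partial>lborel) = (\<integral>\<^sup>+y. \<integral>\<^sup>+x. f (Complex x y) \<partial>lborel \<partial>lborel)"
    unfolding * using lborel_pair.nn_integral_snd[OF m] by simp
qed

text \<open>By Fubini: with the other coordinate fixed, a shear is a translation of the real
  line.\<close>

lemma nn_integral_lborel_shear:
  fixes f :: "complex \<Rightarrow> ennreal" and a :: real
  assumes [measurable]: "f \<in> borel_measurable borel"
  shows "(\<integral>\<^sup>+z. f (Complex (Re z + a * Im z) (Im z)) \<partial>lborel) = (\<integral>\<^sup>+z. f z \<partial>lborel)"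
    and "(\<integral>\<^sup>+z. f (Complex (Re z) (Im z + a * Re z)) \<partial>lborel) = (\<integral>\<^sup>+z. f z \<partial>lborel)"
proof -
  have [measurable]: "(\<lambda>x. f (Complex x y)) \<in> borel_measurable borel" 
     "(\<lambda>x. f (Complex y x)) \<in> borel_measurable borel" for y
    by measurable
  have "(\<integral>\<^sup>+z. f (Complex (Re z + a * Im z) (Im z)) \<partial>lborel)
    = (\<integral>\<^sup>+y. \<integral>\<^sup>+x. f (Complex (a * y + 1 * x) y) \<partial>lborel \<partial>lborel)"
    by (subst nn_integral_lborel_complex(2)) (simp_all add: add.commute)
  also have "\<dots> = (\<integral>\<^sup>+z. f z \<partial>lborel)"
    using nn_integral_real_affine[of "\<lambda>x. f (Complex x _)" 1]
    by (simp add: nn_integral_lborel_complex(2)[of f])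
  finally show "(\<integral>\<^sup>+z. f (Complex (Re z + a * Im z) (Im z)) \<partial>lborel) = (\<integral>\<^sup>+z. f z \<partial>lborel)" .
  have "(\<integral>\<^sup>+z. f (Complex (Re z) (Im z + a * Re z)) \<partial>lborel)
    = (\<integral>\<^sup>+x. \<integral>\<^sup>+y. f (Complex x (a * x + 1 * y)) \<partial>lborel \<partial>lborel)"
    by (subst nn_integral_lborel_complex(1)) (simp_all add: add.commute)
  also have "\<dots> = (\<integral>\<^sup>+z. f z \<partial>lborel)"
    using nn_integral_real_affine[of "\<lambda>y. f (Complex _ y)" 1]
    by (simp add: nn_integral_lborel_complex(1)[of f])
  finally show "(\<integral>\<^sup>+z. f (Complex (Re z) (Im z + a * Re z)) \<partial>lborel) = (\<integral>\<^sup>+z. f z \<partial>lborel)" .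
qed

lemma nn_integral_lborel_cis:
  fixes f :: "complex \<Rightarrow> ennreal"
  assumes [measurable]: "f \<in> borel_measurable borel"
  shows "(\<integral>\<^sup>+z. f (cis t * z) \<partial>lborel) = (\<integral>\<^sup>+z. f z \<partial>lborel)"
proof -
  have main: "(\<integral>\<^sup>+z. f (cis (2 * s) * z) \<partial>lborel) = (\<integral>\<^sup>+z. f z \<partial>lborel)"
    if s: "cos s \<noteq> 0" and f [measurable]: "f \<in> borel_measurable borel" for s and f :: "complex \<Rightarrow> ennreal"
  proof -
    \<comment> \<open>A rotation by \<open>2 * s\<close> is the composition of the three shears \<open>X \<circ> Y \<circ> X\<close>.\<close>
    define X where "X z = Complex (Re z - tan s * Im z) (Im z)" for z
    define Y where "Y z = Complex (Re z) (Im z + sin (2 * s) * Re z)" for z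
    have [measurable]: "X \<in> borel_measurable borel" "Y \<in> borel_measurable borel"
      unfolding X_def Y_def by measurable
    have "(\<integral>\<^sup>+z. f z \<partial>lborel) = (\<integral>\<^sup>+z. f (X z) \<partial>lborel)"
      using nn_integral_lborel_shear(1)[of f "- tan s"] by (simp add: X_def)
    also have "\<dots> = (\<integral>\<^sup>+z. f (X (Y z)) \<partial>lborel)"
      using nn_integral_lborel_shear(2)[of "\<lambda>z. f (X z)" "sin (2 * s)"] by (simp add: Y_def)
    also have "\<dots> = (\<integral>\<^sup>+z. f (X (Y (X z))) \<partial>lborel)"
      using nn_integral_lborel_shear(1)[of "\<lambda>z. f (X (Y z))" "- tan s"] by (simp add: X_def)
    finally have "(\<integral>\<^sup>+z. f z \<partial>lborel) = (\<integral>\<^sup>+z. f (X (Y (X z))) \<partial>lborel)" .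
    moreover have "X (Y (X z)) = cis (2 * s) * z" for z
    proof -
      have t: "tan s * cos s = sin s" using s by (simp add: tan_def)
      \<comment> \<open>This identity and the next turn the entries of the product of shears into
        those of the rotation matrix.\<close>
      have *: "tan s * sin (2 * s) = 1 - cos (2 * s)"
        using t by (simp add: sin_double cos_double_sin power2_eq_square)
      have **: "tan s * (1 + cos (2 * s)) = sin (2 * s)"
        using t by (simp add: sin_double cos_double_cos power2_eq_square)
      have "Re (X (Y (X z))) = (1 - tan s * sin (2 * s)) * Re z - tan s * (1 + (1 - tan s * sin (2 * s))) * Im z"
        "Im (X (Y (X z))) = sin (2 * s) * Re z + (1 - tan s * sin (2 * s)) * Im z"
        by (simp_all add: X_def Y_def algebra_simps)
      then show ?thesis
        unfolding * by (simp add: complex_eq_iff **)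
    qed
    ultimately show ?thesis by simp
  qed
  \<comment> \<open>A quarter of the argument stays within \<open>pi / 4\<close> in modulus, hence
    \<open>cos s \<noteq> 0\<close>; half of it could be \<open>pi / 2\<close>. The rotation by
    \<open>2 * s\<close> is then performed twice.\<close>
  define s where "s = Arg (cis t) / 4"
  have s: "- pi / 4 < s" "s \<le> pi / 4" using Arg_bounded[of "cis t"] by (auto simp: s_def)
  then have c: "cos s \<noteq> 0" using cos_gt_zero_pi[of s] pi_gt_zero by simp
  have "cis t = cis (4 * s)" by (simp add: s_def cis_Arg)
  then have "cis t = cis (2 * s) * cis (2 * s)" by (simp add: cis_mult)
  then show ?thesis
    using main[OF c, of "\<lambda>z. f (cis (2 * s) * z)"] main[OF c assms] by (simp add: mult.assoc)
qed

text \<open>Invariance of \<open>lborel\<close> passes to its completion because preimages of null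
  sets are null sets. The completion matters since weights are Lebesgue measurable.\<close>

lemma lebesgue_distr_cis:
  shows "(\<lambda>z. cis t * z) \<in> lebesgue \<rightarrow>\<^sub>M lebesgue" and "distr lebesgue lebesgue (\<lambda>z. cis t * z) = lebesgue"
proof -
  let ?T = "\<lambda>z. cis t * z"
  have eq: "distr lborel lborel ?T = lborel"
  proof (rule measure_eqI)
    fix A assume "A \<in> sets (distr lborel lborel ?T)"
    then have A[measurable]: "A \<in> sets borel" by simp
    have "emeasure (distr lborel lborel ?T) A = (\<integral>\<^sup>+z. indicator A z \<partial>distr lborel lborel ?T)"
      by simp
    also have "\<dots> = (\<integral>\<^sup>+z. indicator A (?T z) \<partial>lborel)"
      by (rule nn_integral_distr) auto
    also have "\<dots> = (\<integral>\<^sup>+z. indicator A z \<partial>lborel)"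
      by (rule nn_integral_lborel_cis) measurable
    finally show "emeasure (distr lborel lborel ?T) A = emeasure lborel A" by simp
  qed simp
  have d: "distr lebesgue lborel ?T = lborel"
    using eq by (simp add: distr_completion)
  have m: "?T \<in> lebesgue \<rightarrow>\<^sub>M lborel"
    by (simp add: measurable_completion)
  show "?T \<in> lebesgue \<rightarrow>\<^sub>M lebesgue"
    by (rule completion.measurable_completion2[OF m]) (simp add: d)
  show "distr lebesgue lebesgue ?T = lebesgue"
    using completion.completion_distr_eq[OF m] d by simp
qed

section \<open>Rotation invariant measures on the disk\<close>

text \<open>Averages the rotation invariance over the angle: the integral equals its mean over all
  rotations, and Fubini moves this mean inside.\<close>

lemma nn_integral_circle_mean:
  fixes \<mu> :: "complex measure" and a :: "complex \<Rightarrow> real"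
  assumes fin: "finite_measure \<mu>" and id: "(\<lambda>z. z) \<in> borel_measurable \<mu>"
    and rot: "\<And>F t. F \<in> borel_measurable \<mu> \<Longrightarrow> (\<integral>\<^sup>+z. F (cis t * z) \<partial>\<mu>) = (\<integral>\<^sup>+z. F z \<partial>\<mu>)"
    and S: "open S" "continuous_on S a" "\<And>z. z \<in> S \<Longrightarrow> 0 \<le> a z"
    and A: "A \<in> sets borel" "A \<subseteq> S" "\<And>z t. cis t * z \<in> A \<longleftrightarrow> z \<in> A"
  shows "(\<integral>\<^sup>+z. ennreal (a z) * indicator A z \<partial>\<mu>) =
    (\<integral>\<^sup>+z. ennreal (integral {0..1} (\<lambda>t. a (z * cis (2 * pi * t)))) * indicator A z \<partial>\<mu>)"
proof -
  interpret finite_measure \<mu> by fact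
  interpret pair_sigma_finite \<mu> "lborel :: real measure" ..
  note [measurable] = id A(1)
  \<comment> \<open>Extension of \<open>a\<close> by 0, which is Borel on the whole plane; nothing
    changes on \<open>A\<close>.\<close>
  define b where "b z = (indicator S z *\<^sub>R a z :: real)" for z
  have [measurable]: "b \<in> borel_measurable borel"
    unfolding b_def using S by (intro borel_measurable_continuous_on_indicator) auto
  define F where "F z = ennreal (b z) * indicator A z" for z
  have F [measurable]: "F \<in> borel_measurable borel"
    unfolding F_def by measurable
  have F\<mu>: "F \<in> borel_measurable \<mu>" using measurable_compose[OF id F] by simp
  have Fa: "F z = ennreal (a z) * indicator A z" for z
    using A(2) by (auto simp: F_def b_def split: split_indicator)
  have cis_meas [measurable]: "cis \<in> borel_measurable borel"
    by (intro borel_measurable_continuous_onI continuous_intros)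
  have "(\<lambda>q. fst q * cis (2 * pi * snd q)) \<in> borel_measurable (\<mu> \<Otimes>\<^sub>M lborel)"
    using measurable_compose[OF measurable_fst id, of lborel] by measurable
  from measurable_compose[OF this F]
  have meas: "(\<lambda>q. F (fst q * cis (2 * pi * snd q)) * indicator {0..1} (snd q))
      \<in> borel_measurable (\<mu> \<Otimes>\<^sub>M lborel)"
    by measurable
  have "(\<integral>\<^sup>+z. ennreal (a z) * indicator A z \<partial>\<mu>) = (\<integral>\<^sup>+z. F z \<partial>\<mu>)"
    by (simp add: Fa)
  \<comment> \<open>The interval \<open>{0..1}\<close> has length 1, so the constant can be spread
    over it.\<close>
  also have "\<dots> = (\<integral>\<^sup>+t. (\<integral>\<^sup>+z. F z \<partial>\<mu>) * indicator {0..1::real} t \<partial>lborel)"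
    by (subst nn_integral_cmult_indicator) auto
  also have "\<dots> = (\<integral>\<^sup>+t. (\<integral>\<^sup>+z. F (z * cis (2 * pi * t)) * indicator {0..1} t \<partial>\<mu>) \<partial>lborel)"
  proof (rule nn_integral_cong)
    fix t :: real
    have "(\<lambda>z. F (z * cis (2 * pi * t))) \<in> borel_measurable \<mu>"
      by measurable
    then show "(\<integral>\<^sup>+z. F z \<partial>\<mu>) * indicator {0..1} t = (\<integral>\<^sup>+z. F (z * cis (2 * pi * t)) * indicator {0..1} t \<partial>\<mu>)"
      using rot[OF F\<mu>, of "2 * pi * t"] by (subst nn_integral_multc) (auto simp: mult.commute)
  qed
  also have "\<dots> = (\<integral>\<^sup>+z. (\<integral>\<^sup>+t. F (z * cis (2 * pi * t)) * indicator {0..1} t \<partial>lborel) \<partial>\<mu>)"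
    using Fubini'[of "\<lambda>z t. F (z * cis (2 * pi * t)) * indicator {0..1} t"] meas by (simp add: split_beta')
  also have "\<dots> = (\<integral>\<^sup>+z. ennreal (integral {0..1} (\<lambda>t. a (z * cis (2 * pi * t)))) * indicator A z \<partial>\<mu>)"
  proof (rule nn_integral_cong)
    fix z :: complex
    \<comment> \<open>\<open>A\<close> is a union of circles, so its indicator is constant along the
      circle of \<open>z\<close>.\<close>
    have Az: "z * cis t \<in> A \<longleftrightarrow> z \<in> A" for t using A(3)[of t z] by (simp add: mult.commute)
    show "(\<integral>\<^sup>+t. F (z * cis (2 * pi * t)) * indicator {0..1} t \<partial>lborel) =
      ennreal (integral {0..1} (\<lambda>t. a (z * cis (2 * pi * t)))) * indicator A z"
    proof (cases "z \<in> A")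
      case True
      then have inS: "z * cis (2 * pi * t) \<in> S" for t using Az A(2) by blast
      have "continuous_on {0..1} (\<lambda>t. a (z * cis (2 * pi * t)))"
        by (rule continuous_on_compose2[OF S(2)]) (auto intro!: continuous_intros inS)
      then have "(\<lambda>t. a (z * cis (2 * pi * t))) integrable_on {0..1}"
        by (rule integrable_continuous_real)
      then have "integral\<^sup>N lborel (\<lambda>t. ennreal (indicator {0..1} t * a (z * cis (2 * pi * t))))
          = ennreal (integral {0..1} (\<lambda>t. a (z * cis (2 * pi * t))))"
        by (intro nn_integral_has_integral_lebesgue integrable_integral S(3) inS)
      moreover have "ennreal (indicator {0..1} t * a (z * cis (2 * pi * t))) =
          F (z * cis (2 * pi * t)) * indicator {0..1} t" for t
        using True Az by (simp add: Fa split: split_indicator)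
      ultimately show ?thesis using True by simp
    next
      case False
      then show ?thesis using Az by (simp add: Fa)
    qed
  qed
  finally show ?thesis .
qed

text \<open>Continuity from above along balls shrinking to the null set \<open>{0}\<close>.\<close>

lemma finite_measure_ball_small:
  fixes \<mu> :: "complex measure"
  assumes fin: "finite_measure \<mu>" and id: "(\<lambda>z. z) \<in> borel_measurable \<mu>" and sp: "space \<mu> = ball 0 1"
    and z: "emeasure \<mu> {0} = 0" and e: "0 < e" and r: "0 < (r::real)" "r < 1"
  obtains c where "0 < c" "c \<le> r" "emeasure \<mu> (ball 0 c) < e"
proof -
  interpret finite_measure \<mu> by fact
  define B where "B n = ball (0::complex) (r / real (Suc n))" for n
  have sub: "B n \<subseteq> ball 0 1" for n
  proof -
    have "r / real (Suc n) \<le> r" using r by (simp add: divide_le_eq)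
    then show ?thesis using r by (auto simp: B_def)
  qed
  have Bm: "B n \<in> sets \<mu>" for n
  proof -
    have "(\<lambda>z. z) -` B n \<inter> space \<mu> \<in> sets \<mu>"
      by (rule measurable_sets[OF id]) (simp add: B_def)
    then show ?thesis using sub[of n] sp by (simp add: Int_absorb2)
  qed
  have "(\<lambda>n. emeasure \<mu> (B n)) \<longlonglongrightarrow> emeasure \<mu> (\<Inter>n. B n)"
  proof (rule Lim_emeasure_decseq)
    show "decseq B" unfolding B_def decseq_def
      using r by (auto intro!: subset_ball divide_left_mono)
  qed (use Bm in auto)
  moreover have "(\<Inter>n. B n) = {0}"
  proof (intro equalityI subsetI)
    fix x assume "x \<in> (\<Inter>n. B n)"
    then have x: "cmod x < r / real (Suc n)" for n by (auto simp: B_def)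
    have "(\<lambda>n. r / real (Suc n)) \<longlonglongrightarrow> 0"
      by (rule LIMSEQ_Suc[OF lim_const_over_n])
    then have "cmod x \<le> 0"
      by (rule LIMSEQ_le_const) (use x less_imp_le in blast)
    then show "x \<in> {0}" by simp
  qed (use r in \<open>auto simp: B_def\<close>)
  ultimately have "(\<lambda>n. emeasure \<mu> (B n)) \<longlonglongrightarrow> 0" using z by simp
  then have "eventually (\<lambda>n. emeasure \<mu> (B n) < e) sequentially"
    using e by (rule order_tendstoD(2))
  then obtain n where "emeasure \<mu> (B n) < e" by (auto simp: eventually_sequentially)
  then show thesis
    using that[of "r / real (Suc n)"] r by (simp add: B_def divide_le_eq)
qed

text \<open>Countably many closed annuli exhaust the disk without the origin; if all were null, so
  would be the disk.\<close>

lemma exists_annulus_positive_measure: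
  fixes \<mu> :: "complex measure"
  assumes id: "(\<lambda>z. z) \<in> borel_measurable \<mu>" and sp: "space \<mu> = ball 0 1"
    and z: "emeasure \<mu> {0} = 0" and pos: "emeasure \<mu> (space \<mu>) \<noteq> 0"
  obtains r1 r2 :: real where "0 < r1" "r1 \<le> r2" "r2 < 1" "emeasure \<mu> {z. r1 \<le> cmod z \<and> cmod z \<le> r2} \<noteq> 0"
proof -
  have b: "X \<inter> ball 0 1 \<in> sets \<mu>" if "X \<in> sets borel" for X
    using measurable_sets[OF id that] sp by simp
  \<comment> \<open>The shift by 2 gives \<open>1 / (n + 2) \<le> 1 / 2\<close>, so the inner radius
    does not exceed the outer one.\<close>
  define A where "A n = {z. 1 / real (n + 2) \<le> cmod z \<and> cmod z \<le> 1 - 1 / real (n + 2)}" for n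
  have sub: "A n \<subseteq> ball 0 1" for n
  proof
    fix x assume "x \<in> A n"
    moreover have "0 < 1 / real (n + 2)" by simp
    ultimately have "cmod x < 1" unfolding A_def mem_Collect_eq by linarith
    then show "x \<in> ball 0 1" by simp
  qed
  have Am: "A n \<in> sets \<mu>" for n
  proof -
    have "closed (A n)" unfolding A_def
      by (intro closed_Collect_conj closed_Collect_le continuous_intros)
    then show ?thesis using b[of "A n"] sub[of n] by (simp add: Int_absorb2)
  qed
  have "\<exists>n. emeasure \<mu> (A n) \<noteq> 0"
  proof (rule ccontr)
    assume "\<not> ?thesis"
    then have "emeasure \<mu> (\<Union>n. A n) = 0"
      by (intro emeasure_UN_eq_0) (use Am in auto)
    moreover have "space \<mu> = {0} \<union> (\<Union>n. A n)"
    proof (intro equalityI subsetI)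
      fix x assume x: "x \<in> space \<mu>"
      show "x \<in> {0} \<union> (\<Union>n. A n)"
      proof (cases "x = 0")
        case False
        define d where "d = min (cmod x) (1 - cmod x)"
        have "0 < d" using x False sp by (simp add: d_def)
        then obtain n where "inverse (real (Suc n)) < d" using reals_Archimedean by blast
        moreover have "1 / real (n + 2) \<le> inverse (real (Suc n))"
          by (simp add: inverse_eq_divide frac_le)
        ultimately have "x \<in> A n" by (auto simp: A_def d_def)
        then show ?thesis by auto
      qed simp
    qed (use sub sp in \<open>force simp: subset_eq\<close>)
    moreover have "{0} \<in> sets \<mu>" using b[of "{0}"] by simp
    moreover have "(\<Union>n. A n) \<in> sets \<mu>" using Am by auto
    ultimately have "emeasure \<mu> (space \<mu>) \<le> 0"
      using emeasure_subadditive[of "{0}" \<mu> "\<Union>n. A n"] z by simp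
    then show False using pos by simp
  qed
  then obtain n where "emeasure \<mu> (A n) \<noteq> 0" by blast
  moreover have "1 / real (n + 2) \<le> 1 / 2" by (simp add: frac_le)
  then have "1 / real (n + 2) \<le> 1 - 1 / real (n + 2)" by simp
  moreover have "0 < 1 / real (n + 2)" by simp
  ultimately show thesis
    using that[of "1 / real (n + 2)" "1 - 1 / real (n + 2)"] by (simp add: A_def del: of_nat_add)
qed

text \<open>If \<open>Q\<close> is the largest excess near 0, every circle of the annulus
  \<open>A\<close> gains at least \<open>Q / M\<close> in the mean. With \<open>m\<close> the
  measure of \<open>A\<close>, the total gain is at least \<open>Q * (m / M)\<close>, while the
  small disk loses at most \<open>Q\<close> times its own measure.\<close>

lemma rotation_invariant_domination:
  fixes \<mu> :: "complex measure" and p :: real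
  assumes fin: "finite_measure \<mu>" and id: "(\<lambda>z. z) \<in> borel_measurable \<mu>" and sp: "space \<mu> = ball 0 1"
    and z: "emeasure \<mu> {0} = 0" and pos: "emeasure \<mu> (space \<mu>) \<noteq> 0"
    and rot: "\<And>F t. F \<in> borel_measurable \<mu> \<Longrightarrow> (\<integral>\<^sup>+z. F (cis t * z) \<partial>\<mu>) = (\<integral>\<^sup>+z. F z \<partial>\<mu>)"
    and p: "1 \<le> p"
  obtains c where "0 < c" "c < 1"
    "\<And>f g. f holomorphic_on ball 0 1 \<Longrightarrow> g holomorphic_on ball 0 1 \<Longrightarrow>
      (\<And>z. c \<le> cmod z \<Longrightarrow> cmod z < 1 \<Longrightarrow> cmod (f z) \<le> cmod (g z)) \<Longrightarrow>
      (\<integral>\<^sup>+z. ennreal (cmod (f z) powr p) \<partial>\<mu>) \<le> (\<integral>\<^sup>+z. ennreal (cmod (g z) powr p) \<partial>\<mu>)"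
proof -
  interpret finite_measure \<mu> by fact
  obtain r1 r2 :: real where r: "0 < r1" "r1 \<le> r2" "r2 < 1"
      and A_pos: "emeasure \<mu> {z. r1 \<le> cmod z \<and> cmod z \<le> r2} \<noteq> 0"
    by (rule exists_annulus_positive_measure[OF id sp z pos])
  obtain M where M: "0 < M"
    "\<And>f g z \<zeta>. f holomorphic_on ball 0 1 \<Longrightarrow> g holomorphic_on ball 0 1 \<Longrightarrow>
      (\<And>z. r1 / 4 \<le> cmod z \<Longrightarrow> cmod z < 1 \<Longrightarrow> cmod (f z) \<le> cmod (g z)) \<Longrightarrow>
      cmod z \<le> r1 / 4 \<Longrightarrow> r1 \<le> cmod \<zeta> \<Longrightarrow> cmod \<zeta> \<le> r2 \<Longrightarrow>
      cmod (f z) powr p - cmod (g z) powr p \<le> M * integral {0..1} (\<lambda>t.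
        cmod (g (\<zeta> * cis (2 * pi * t))) powr p - cmod (f (\<zeta> * cis (2 * pi * t))) powr p)"
    using domination_circle_mean[OF r p] by blast
  define A where "A = {z. r1 \<le> cmod z \<and> cmod z \<le> r2}"
  have A: "A \<in> sets borel"
    unfolding A_def by (intro borel_closed closed_Collect_conj closed_Collect_le continuous_intros)
  have A_sub: "A \<subseteq> ball 0 1" using r by (auto simp: A_def)
  have A_rot: "cis t * z \<in> A \<longleftrightarrow> z \<in> A" for z t by (simp add: A_def norm_mult)
  define m where "m = measure \<mu> A"
  have m: "emeasure \<mu> A = ennreal m" by (simp add: m_def emeasure_eq_measure)
  have "0 < m" using A_pos m by (metis A_def ennreal_0 m_def measure_nonneg order_le_less)
  \<comment> \<open>\<open>m / M\<close> is the break-even mass for the small disk. The bound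
    \<open>c \<le> r1 / 4\<close> makes domination from \<open>c\<close> on imply the domination
    that the choice of \<open>M\<close> presupposes.\<close>
  then have "0 < ennreal (m / M)" using M(1) by simp
  then obtain c where c: "0 < c" "c \<le> r1 / 4" "emeasure \<mu> (ball 0 c) < ennreal (m / M)"
    by (rule finite_measure_ball_small[OF fin id sp z, of _ "r1/4"]) (use r in auto)
  define B where "B = ball (0::complex) c"
  define E where "E = - (A \<union> B)"
  have sets: "A \<in> sets borel" "B \<in> sets borel" "E \<in> sets borel"
    using A by (auto simp: B_def E_def)
  have ind [measurable]: "indicator X \<in> borel_measurable \<mu>" if "X \<in> sets borel" for X :: "complex set"
    using measurable_compose[OF id borel_measurable_indicator[OF that]] by simp
  have disj: "A \<inter> B = {}" using c r by (auto simp: A_def B_def)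
  show thesis
  proof (rule that[of c])
    show "0 < c" "c < 1" using c r by auto
    fix f g :: "complex \<Rightarrow> complex"
    assume f: "f holomorphic_on ball 0 1" and g: "g holomorphic_on ball 0 1"
      and le: "\<And>z. c \<le> cmod z \<Longrightarrow> cmod z < 1 \<Longrightarrow> cmod (f z) \<le> cmod (g z)"
    define a where "a z = cmod (f z) powr p" for z
    define b where "b z = cmod (g z) powr p" for z
    have a0: "0 \<le> a z" and b0: "0 \<le> b z" for z by (auto simp: a_def b_def)
    have cont: "continuous_on (ball 0 1) a" "continuous_on (ball 0 1) b"
      unfolding a_def b_def using p
      by (auto intro!: continuous_intros continuous_on_powr' holomorphic_on_imp_continuous_on f g)
    have meas: "(\<lambda>z. ennreal (h z)) \<in> borel_measurable \<mu>" if h: "continuous_on (ball 0 1) h" for h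
    proof -
      have "(\<lambda>z. indicator (ball 0 1) z *\<^sub>R h z) \<in> borel_measurable borel"
        by (rule borel_measurable_continuous_on_indicator[OF _ h]) auto
      from measurable_compose[OF id this]
      have "(\<lambda>z. ennreal (indicator (ball 0 1) z *\<^sub>R h z)) \<in> borel_measurable \<mu>" by measurable
      then show ?thesis by (rule measurable_cong[THEN iffD1, rotated]) (simp add: sp)
    qed
    note [measurable] = meas[OF cont(1)] meas[OF cont(2)] ind[OF sets(1)] ind[OF sets(2)] ind[OF sets(3)]
    have ab: "a z \<le> b z" if "c \<le> cmod z" "cmod z < 1" for z
      unfolding a_def b_def using le[OF that] p by (intro powr_mono2) auto
    obtain y where y: "y \<in> cball 0 c" "\<And>z. z \<in> cball 0 c \<Longrightarrow> a z - b z \<le> a y - b y"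
    proof -
      have "continuous_on (cball 0 c) (\<lambda>z. a z - b z)"
        by (intro continuous_intros continuous_on_subset[OF cont(1)] continuous_on_subset[OF cont(2)])
          (use c r in auto)
      then show thesis
        using continuous_attains_sup[of "cball (0::complex) c" "\<lambda>z. a z - b z"] c that by auto
    qed
    \<comment> \<open>Truncation at 0 keeps \<open>Q\<close> faithful as an \<open>ennreal\<close>
      and covers the case without excess.\<close>
    define Q where "Q = max 0 (a y - b y)"
    have Q0: "0 \<le> Q" by (simp add: Q_def)
    define mb where "mb z = integral {0..1} (\<lambda>t. b (z * cis (2 * pi * t)))" for z
    \<comment> \<open>Written with \<open>Q / M\<close> added to \<open>a\<close>, since
      \<open>b - a\<close> can be negative on the disk and \<open>nn_integral_circle_mean\<close>
      takes nonnegative functions.\<close>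
    have mean: "integral {0..1} (\<lambda>t. a (z * cis (2 * pi * t)) + Q / M) \<le> mb z" if z: "z \<in> A" for z
    proof -
      have in_ann: "r1 \<le> cmod (z * cis t)" "cmod (z * cis t) \<le> r2" for t
        using z by (auto simp: A_def norm_mult)
      have *: "z * cis t \<in> ball 0 1" for t using in_ann[of t] r by simp
      have int: "(\<lambda>t. a (z * cis (2 * pi * t))) integrable_on {0..1}"
        "(\<lambda>t. b (z * cis (2 * pi * t))) integrable_on {0..1}"
        by (intro integrable_continuous_real continuous_on_compose2[OF cont(1)]
            continuous_on_compose2[OF cont(2)] continuous_intros; use * in blast)+
      define ma where "ma = integral {0..1} (\<lambda>t. a (z * cis (2 * pi * t)))"
      have diff: "integral {0..1} (\<lambda>t. b (z * cis (2 * pi * t)) - a (z * cis (2 * pi * t))) = mb z - ma"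
        unfolding ma_def mb_def by (intro integral_diff int)
      have "a (z * cis t) \<le> b (z * cis t)" for t
        using in_ann[of t] r c by (intro ab) auto
      then have "ma \<le> mb z" unfolding ma_def mb_def by (intro integral_le int) auto
      moreover have "a y - b y \<le> M * (mb z - ma)"
        unfolding diff[symmetric] unfolding a_def b_def
        by (rule M(2)[OF f g]) (use le c r y(1) z in \<open>auto simp: A_def\<close>)
      ultimately have "Q \<le> M * (mb z - ma)" using M(1) by (simp add: Q_def)
      then have "ma + Q / M \<le> mb z" using M(1) by (simp add: field_simps)
      moreover have "integral {0..1} (\<lambda>t. a (z * cis (2 * pi * t)) + Q / M) = ma + Q / M"
        unfolding ma_def by (subst integral_add) (use int in auto)
      ultimately show ?thesis by simp
    qed
    have split: "(\<integral>\<^sup>+z. h z \<partial>\<mu>) = (\<integral>\<^sup>+z. h z * indicator A z \<partial>\<mu>) + (\<integral>\<^sup>+z. h z * indicator B z \<partial>\<mu>)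
        + (\<integral>\<^sup>+z. h z * indicator E z \<partial>\<mu>)" if [measurable]: "h \<in> borel_measurable \<mu>" for h
    proof -
      have "(\<integral>\<^sup>+z. h z \<partial>\<mu>) = (\<integral>\<^sup>+z. h z * indicator A z + h z * indicator B z + h z * indicator E z \<partial>\<mu>)"
        using disj by (intro nn_integral_cong) (auto simp: E_def split: split_indicator)
      then show ?thesis by (simp add: nn_integral_add)
    qed
    have IE: "(\<integral>\<^sup>+z. ennreal (a z) * indicator E z \<partial>\<mu>) \<le> (\<integral>\<^sup>+z. ennreal (b z) * indicator E z \<partial>\<mu>)"
      using ab sp by (intro nn_integral_mono) (auto simp: E_def B_def ennreal_leI split: split_indicator)
    have "(\<integral>\<^sup>+z. ennreal (a z) * indicator B z \<partial>\<mu>)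
        \<le> (\<integral>\<^sup>+z. ennreal (b z) * indicator B z + ennreal Q * indicator B z \<partial>\<mu>)"
    proof (intro nn_integral_mono)
      fix z
      have "a z \<le> b z + Q" if "z \<in> B" using y(2)[of z] that by (simp add: B_def Q_def)
      then show "ennreal (a z) * indicator B z \<le> ennreal (b z) * indicator B z + ennreal Q * indicator B z"
        using b0 Q0 by (auto simp: ennreal_leI simp flip: ennreal_plus split: split_indicator)
    qed
    also have "\<dots> = (\<integral>\<^sup>+z. ennreal (b z) * indicator B z \<partial>\<mu>) + (\<integral>\<^sup>+z. ennreal Q * indicator B z \<partial>\<mu>)"
      by (rule nn_integral_add) measurable
    also have "(\<integral>\<^sup>+z. ennreal Q * indicator B z \<partial>\<mu>) \<le> ennreal (Q * (m / M))"
    proof -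
      have "B \<in> sets \<mu>"
        using measurable_sets[OF id sets(2)] sp c r by (simp add: B_def Int_absorb2 subset_ball)
      then have "(\<integral>\<^sup>+z. ennreal Q * indicator B z \<partial>\<mu>) = ennreal Q * emeasure \<mu> B"
        by (rule nn_integral_cmult_indicator)
      also have "\<dots> \<le> ennreal Q * ennreal (m / M)"
        using c(3) by (intro mult_left_mono) (auto simp: B_def)
      finally show ?thesis by (simp only: ennreal_mult'[OF Q0])
    qed
    finally have IB: "(\<integral>\<^sup>+z. ennreal (a z) * indicator B z \<partial>\<mu>) \<le>
        (\<integral>\<^sup>+z. ennreal (b z) * indicator B z \<partial>\<mu>) + ennreal (Q * (m / M))" by (simp add: add_left_mono)
    have "A \<in> sets \<mu>"
      using measurable_sets[OF id A] sp A_sub by (simp add: Int_absorb2)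
    then have "(\<integral>\<^sup>+z. ennreal (Q / M) * indicator A z \<partial>\<mu>) = ennreal (Q / M) * ennreal m"
      using m by (simp add: nn_integral_cmult_indicator)
    also have "\<dots> = ennreal (Q * (m / M))"
      using Q0 M(1) \<open>0 < m\<close> by (simp flip: ennreal_mult)
    finally have IQ: "(\<integral>\<^sup>+z. ennreal (Q / M) * indicator A z \<partial>\<mu>) = ennreal (Q * (m / M))" .
    \<comment> \<open>Circle means are introduced for \<open>a + Q / M\<close>, compared by
      \<open>mean\<close>, and removed again for \<open>b\<close>.\<close>
    have "(\<integral>\<^sup>+z. ennreal (a z) * indicator A z \<partial>\<mu>) + ennreal (Q * (m / M)) =
        (\<integral>\<^sup>+z. ennreal (a z + Q / M) * indicator A z \<partial>\<mu>)"
      unfolding IQ[symmetric]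
      using a0 Q0 M(1) by (subst nn_integral_add[symmetric])
        (auto intro!: nn_integral_cong simp: ennreal_plus split: split_indicator)
    also have "\<dots> = (\<integral>\<^sup>+z. ennreal (integral {0..1} (\<lambda>t. a (z * cis (2 * pi * t)) + Q / M)) * indicator A z \<partial>\<mu>)"
      by (rule nn_integral_circle_mean[OF fin id rot, where S = "ball 0 1"])
         (use cont a0 Q0 M(1) A A_sub A_rot in \<open>auto intro!: continuous_intros\<close>)
    also have "\<dots> \<le> (\<integral>\<^sup>+z. ennreal (mb z) * indicator A z \<partial>\<mu>)"
      by (intro nn_integral_mono) (auto intro!: ennreal_leI mean split: split_indicator)
    also have "\<dots> = (\<integral>\<^sup>+z. ennreal (b z) * indicator A z \<partial>\<mu>)"
      unfolding mb_def
      by (rule nn_integral_circle_mean[OF fin id rot, where S = "ball 0 1", symmetric])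
         (use cont b0 A A_sub A_rot in auto)
    finally have IA: "(\<integral>\<^sup>+z. ennreal (a z) * indicator A z \<partial>\<mu>) + ennreal (Q * (m / M)) \<le>
        (\<integral>\<^sup>+z. ennreal (b z) * indicator A z \<partial>\<mu>)" .
    \<comment> \<open>\<open>q\<close> is carried on both sides and cancelled at the end. This is
      sound because \<open>q\<close> is finite, whereas the integrals of \<open>a\<close> and
      \<open>b\<close> may be infinite.\<close>
    define q where "q = ennreal (Q * (m / M))"
    have "(\<integral>\<^sup>+z. a z \<partial>\<mu>) + q = ((\<integral>\<^sup>+z. ennreal (a z) * indicator A z \<partial>\<mu>) + q)
        + (\<integral>\<^sup>+z. ennreal (a z) * indicator B z \<partial>\<mu>) + (\<integral>\<^sup>+z. ennreal (a z) * indicator E z \<partial>\<mu>)"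
      by (subst split) (simp_all add: ac_simps)
    also have "\<dots> \<le> (\<integral>\<^sup>+z. ennreal (b z) * indicator A z \<partial>\<mu>)
        + ((\<integral>\<^sup>+z. ennreal (b z) * indicator B z \<partial>\<mu>) + q) + (\<integral>\<^sup>+z. ennreal (b z) * indicator E z \<partial>\<mu>)"
      using IA IB IE unfolding q_def by (intro add_mono)
    also have "\<dots> = (\<integral>\<^sup>+z. b z \<partial>\<mu>) + q"
      by (subst split) (simp_all add: ac_simps)
    finally have "q + (\<integral>\<^sup>+z. a z \<partial>\<mu>) \<le> q + (\<integral>\<^sup>+z. b z \<partial>\<mu>)" by (simp add: add.commute)
    then show "(\<integral>\<^sup>+z. ennreal (cmod (f z) powr p) \<partial>\<mu>) \<le> (\<integral>\<^sup>+z. ennreal (cmod (g z) powr p) \<partial>\<mu>)"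
      unfolding a_def b_def by (simp add: q_def)
  qed
qed

section \<open>The measure given by a radial weight\<close>

text \<open>Lebesgue measure, the disk and the radial \<open>w\<close> are each preserved by
  rotations.\<close>

lemma bergman_measure_rotation_invariant:
  assumes w: "w \<in> borel_measurable (lebesgue_on unit_disk)" "radial w"
    and F: "F \<in> borel_measurable (lebesgue_on unit_disk)"
  shows "(\<integral>\<^sup>+z. F (cis t * z) \<partial>density disk_area (\<lambda>z. ennreal (w z)))
    = (\<integral>\<^sup>+z. F z \<partial>density disk_area (\<lambda>z. ennreal (w z)))"
proof -
  have *: "(\<integral>\<^sup>+z. G z \<partial>density disk_area (\<lambda>z. ennreal (w z))) =
      ennreal (1 / pi) * (\<integral>\<^sup>+z. ennreal (w z) * G z * indicator unit_disk z \<partial>lebesgue)"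
    if "G \<in> borel_measurable (lebesgue_on unit_disk)" for G
    using w(1) that
    by (simp add: disk_area_def nn_integral_density nn_integral_scale_measure nn_integral_restrict_space)
  \<comment> \<open>Extended by 0 off the disk, so that invariance of Lebesgue measure on the whole
    plane applies.\<close>
  define k where "k z = ennreal (w z) * F z * indicator unit_disk z" for z
  have wF: "(\<lambda>z. ennreal (w z) * F z) \<in> borel_measurable (lebesgue_on unit_disk)"
    using w(1) F by measurable
  then have k: "k \<in> borel_measurable lebesgue"
    unfolding k_def by (subst (asm) borel_measurable_restrict_space_iff_ennreal) auto
  have k_rot: "k (cis t * z) = ennreal (w z) * F (cis t * z) * indicator unit_disk z" for z
  proof (cases "z \<in> unit_disk")
    case True
    then have "w (cis t * z) = w z"
      using w(2) unfolding radial_def by (metis dist_0_norm mem_ball mult_1 norm_cis norm_mult)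
    then show ?thesis by (simp add: k_def norm_mult indicator_def)
  qed (simp add: k_def norm_mult indicator_def)
  \<comment> \<open>The rotation has to be measurable between Lebesgue sets, since \<open>F\<close>
    need not be Borel.\<close>
  have Ft: "(\<lambda>z. F (cis t * z)) \<in> borel_measurable (lebesgue_on unit_disk)"
  proof (rule measurable_compose[OF _ F])
    show "(\<lambda>z. cis t * z) \<in> lebesgue_on unit_disk \<rightarrow>\<^sub>M lebesgue_on unit_disk"
      by (rule measurable_restrict_space2)
         (use measurable_restrict_space1[OF lebesgue_distr_cis(1)] in \<open>auto simp: space_restrict_space norm_mult\<close>)
  qed
  have "(\<integral>\<^sup>+z. k z \<partial>lebesgue) = (\<integral>\<^sup>+z. k (cis t * z) \<partial>lebesgue)"
    using nn_integral_distr[OF lebesgue_distr_cis(1), of k t] k by (simp add: lebesgue_distr_cis(2))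
  then show ?thesis
    unfolding *[OF Ft] *[OF F] k_rot by (simp add: k_def)
qed

theorem theorem2:
  fixes p :: real and w :: "complex \<Rightarrow> real"
  assumes "1 \<le> p"
    and "integrable_weight w"
    and "radial w"
  shows "korenblum_domination p w"
proof -
  have w: "w \<in> borel_measurable (lebesgue_on unit_disk)" "\<And>z. z \<in> unit_disk \<Longrightarrow> 0 \<le> w z"
      "0 < (\<integral>\<^sup>+z. ennreal (w z) \<partial>disk_area)" "(\<integral>\<^sup>+z. ennreal (w z) \<partial>disk_area) < \<infinity>"
    using assms(2) by (auto simp: integrable_weight_def is_weight_def)
  have sets_area: "sets disk_area = sets (lebesgue_on unit_disk)"
    by (simp add: disk_area_def)
  have space_area: "space disk_area = unit_disk"
    by (simp add: disk_area_def space_scale_measure space_restrict_space)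
  have meas_area: "borel_measurable disk_area = borel_measurable (lebesgue_on unit_disk)"
    using sets_area by (rule measurable_cong_sets) simp
  have wm [measurable]: "(\<lambda>z. ennreal (w z)) \<in> borel_measurable disk_area"
    unfolding meas_area using w(1) by measurable
  \<comment> \<open>Absorbs the weight into a finite rotation invariant measure, the setting of
    \<open>rotation_invariant_domination\<close>.\<close>
  define \<mu> where "\<mu> = density disk_area (\<lambda>z. ennreal (w z))"
  have meas_\<mu>: "borel_measurable \<mu> = borel_measurable (lebesgue_on unit_disk)"
    unfolding \<mu>_def by (rule measurable_cong_sets) (simp_all add: sets_area)
  have id: "(\<lambda>z. z) \<in> borel_measurable (lebesgue_on unit_disk)"
    by (intro measurable_restrict_space1) (simp add: measurable_completion)
  have sp: "space \<mu> = ball 0 1" by (simp add: \<mu>_def space_area)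
  have total: "emeasure \<mu> (space \<mu>) = (\<integral>\<^sup>+z. ennreal (w z) \<partial>disk_area)"
    unfolding \<mu>_def by (subst emeasure_density) (auto intro!: nn_integral_cong)
  have fin: "finite_measure \<mu>"
    by (rule finite_measureI) (use total w(4) in auto)
  have zero: "emeasure \<mu> {0} = 0"
  proof -
    \<comment> \<open>The origin has area 0, and a density puts no mass on null sets.\<close>
    have "{0} \<in> null_sets disk_area"
      by (auto simp: null_sets_def disk_area_def sets_restrict_space emeasure_restrict_space)
    then have "{0} \<in> null_sets \<mu>"
      using absolutely_continuousI_density[OF wm] by (auto simp: \<mu>_def absolutely_continuous_def)
    then show ?thesis by auto
  qed
  obtain c where c: "0 < c" "c < 1"
    "\<And>f g. f holomorphic_on ball 0 1 \<Longrightarrow> g holomorphic_on ball 0 1 \<Longrightarrow>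
      (\<And>z. c \<le> cmod z \<Longrightarrow> cmod z < 1 \<Longrightarrow> cmod (f z) \<le> cmod (g z)) \<Longrightarrow>
      (\<integral>\<^sup>+z. ennreal (cmod (f z) powr p) \<partial>\<mu>) \<le> (\<integral>\<^sup>+z. ennreal (cmod (g z) powr p) \<partial>\<mu>)"
    by (rule rotation_invariant_domination[OF fin _ sp zero _ _ assms(1)])
       (use w total id bergman_measure_rotation_invariant[OF w(1) assms(3)] in \<open>auto simp: meas_\<mu> simp flip: \<mu>_def\<close>)
  have integral_eq: "bergman_integral p w f = (\<integral>\<^sup>+z. ennreal (cmod (f z) powr p) \<partial>\<mu>)"
    if "f holomorphic_on unit_disk" for f
  proof -
    have "continuous_on unit_disk (\<lambda>z. cmod (f z) powr p)"
      using assms(1) that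
      by (auto intro!: continuous_intros continuous_on_powr' holomorphic_on_imp_continuous_on)
    then have [measurable]: "(\<lambda>z. cmod (f z) powr p) \<in> borel_measurable disk_area"
      unfolding meas_area by (intro continuous_imp_measurable_on_sets_lebesgue) auto
    show ?thesis
      unfolding bergman_integral_def \<mu>_def
      by (subst nn_integral_density) (auto intro!: nn_integral_cong simp: space_area w(2) ennreal_mult mult.commute)
  qed
  show ?thesis
    unfolding korenblum_domination_def
  proof (intro exI[of _ c] conjI ballI impI c(1,2))
    fix f g
    assume "f \<in> bergman_space p w" "g \<in> bergman_space p w"
      and le: "\<forall>z. c \<le> cmod z \<and> cmod z < 1 \<longrightarrow> cmod (f z) \<le> cmod (g z)"
    then have fg: "f holomorphic_on unit_disk" "g holomorphic_on unit_disk" "bergman_integral p w g < \<infinity>"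
      by (auto simp: bergman_space_def)
    have "bergman_integral p w f \<le> bergman_integral p w g"
      unfolding integral_eq[OF fg(1)] integral_eq[OF fg(2)] using le by (intro c(3) fg) auto
    \<comment> \<open>\<open>enn2real\<close> sends infinity to 0, so monotonicity rests on the
      finite integral of \<open>g\<close>.\<close>
    then have "enn2real (bergman_integral p w f) \<le> enn2real (bergman_integral p w g)"
      using fg(3) by (intro enn2real_mono) auto
    then show "bergman_norm p w f \<le> bergman_norm p w g"
      unfolding bergman_norm_def using assms(1) by (intro powr_mono2) auto
  qed
qed

end
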